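(* Let $n\ge 2$, let $\sigma_1,\ldots,\sigma_n$ be weights on $\mathbb{R}^d$, let $K:\mathcal{D}\to[0,\infty)$ be a map, and let $\mathcal{S}\subset\mathcal{D}$ be an $\eta$-sparse family, where $0<\eta<1$. Let $1<p_1,\ldots,p_n<\infty$ with $\frac1{p_1}+\cdots+\frac1{p_n}<1$, and define $r$ by $\frac1r+\frac1{p_1}+\cdots+\frac1{p_n}=1$. Then there is a finite constant $c$, independent of the functions $f_1,\dots,f_n$, of $K$, and of $\mathcal{S}$ (except through $\eta$), such that for all nonnegative functions $f_1,\ldots,f_n\in L^1_{\rm loc}(dx)$ the multilinear embedding inequality $$\sum_{S\in\mathcal{S}}K(S)\prod_{i=1}^n\int_S f_i\,d\sigma_i\le c\,A_0\prod_{i=1}^n\|f_i\|_{L^{p_i}(\sigma_i)}$$ holds in each of the following two cases. (a) $\sigma_1,\ldots,\sigma_n\in A_\infty$ and $$A_0=\left[\sum_{S\in\mathcal{S}}\left(K(S)|S|^{n-1}\prod_{i=1}^n\left(\frac{\sigma_i(S)}{|S|}\right)^{1/p_i'}\right)^r|E_{\mathcal{S}}(S)|\right]^{1/r}<\infty.$$ (b) For some $\theta>1$ (the constant $c$ may depend on $\theta$), $$A_0=\left[\sum_{S\in\mathcal{S}}\left(K(S)|S|^{n-1}\prod_{i=1}^n\left(\frac{\sigma_i^{\theta}(S)}{|S|}\right)^{\frac1{\theta p_i'}}\right)^r|E_{\mathcal{S}}(S)|\right]^{1/r}<\infty.$$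
   Context: $\mathcal{D}=\{2^{-k}(m+[0,1)^d):k\in\mathbb{Z},m\in\mathbb{Z}^d\}$ is the family of dyadic cubes in $\mathbb{R}^d$. For $0<\eta<1$, a family $\mathcal{S}\subset\mathcal{D}$ is $\eta$-sparse if for every $S\in\mathcal{S}$ there is a measurable set $E_{\mathcal{S}}(S)\subset S$ with $|E_{\mathcal{S}}(S)|\ge\eta|S|$, and the sets $\{E_{\mathcal{S}}(S):S\in\mathcal{S}\}$ are pairwise disjoint; a choice of these sets is fixed, and $|E|$ denotes Lebesgue measure. A weight is a nonnegative locally integrable function $\sigma$ on $\mathbb{R}^d$; $d\sigma=\sigma\,dx$, $\sigma(S)=\int_S\sigma\,dx$, $\sigma^\theta(S)=\int_S\sigma^\theta\,dx$, $\|f\|_{L^p(\sigma)}=(\int_{\mathbb{R}^d}|f|^p\sigma\,dx)^{1/p}$. The conjugate exponent is $p'=p/(p-1)$. For $1<p<\infty$, $$[w]_{A_p}=\sup_{Q}\left(\frac1{|Q|}\int_Q w\,dx\right)\left(\frac1{|Q|}\int_Q w^{-\frac1{p-1}}\,dx\right)^{p-1},$$ the supremum being over all cubes $Q\subset\mathbb{R}^d$ with sides parallel to the axes, and $w\in A_\infty$ means $[w]_{A_\infty}:=\lim_{p\to\infty}[w]_{A_p}<\infty$ (in particular $w\in A_p$ for some $1<p<\infty$). The usual convention $0\cdot\infty=0$ is used. *)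

theory Defs
  imports "HOL-Analysis.Analysis"
begin

(* The real power on [0,\<infinity>] with 0 and \<infinity> exchanged by negative exponents. On real, 0 powr a is
   0 for every a, so powr would give w^(-1/(p-1)) = 0 on the zero set of w. *)
definition epowr :: "ennreal \<Rightarrow> real \<Rightarrow> ennreal" (infixr "epowr" 80) where
  "x epowr a =
     (if a = 0 then 1
      else if x = 0 then (if a < 0 then top else 0)
      else if x = top then (if a < 0 then 0 else top)
      else ennreal (enn2real x powr a))"

definition conj_exp :: "real \<Rightarrow> real" where
  "conj_exp p = p / (p - 1)"

definition dyadic_cubes :: "(real ^ 'd) set set" where
  "dyadic_cubes =
     {(\<lambda>x. (2 powi (- k)) *\<^sub>R ((\<chi> i. of_int (m $ i)) + x)) ` {x. \<forall>i. x $ i \<in> {0..<1}}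
       | (k :: int) (m :: int ^ 'd). True}"

(* E is the fixed choice of the pairwise disjoint subsets E(S). *)
definition sparse_family ::
    "real \<Rightarrow> (real ^ 'd) set set \<Rightarrow> ((real ^ 'd) set \<Rightarrow> (real ^ 'd) set) \<Rightarrow> bool" where
  "sparse_family \<eta> \<S> E \<longleftrightarrow>
     \<S> \<subseteq> dyadic_cubes \<and>
     (\<forall>S\<in>\<S>. E S \<in> sets lebesgue \<and> E S \<subseteq> S \<and>
        ennreal \<eta> * emeasure lebesgue S \<le> emeasure lebesgue (E S)) \<and>
     disjoint_family_on E \<S>"

definition locally_integrable :: "(real ^ 'd \<Rightarrow> real) \<Rightarrow> bool" where
  "locally_integrable f \<longleftrightarrow> (\<forall>C. compact C \<longrightarrow> f absolutely_integrable_on C)"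

definition weight :: "(real ^ 'd \<Rightarrow> real) \<Rightarrow> bool" where
  "weight \<sigma> \<longleftrightarrow> (\<forall>x. 0 \<le> \<sigma> x) \<and> locally_integrable \<sigma>"

definition wmeasure :: "(real ^ 'd \<Rightarrow> real) \<Rightarrow> (real ^ 'd) set \<Rightarrow> ennreal" where
  "wmeasure \<sigma> S = (\<integral>\<^sup>+x\<in>S. ennreal (\<sigma> x) \<partial>lebesgue)"

definition wnorm :: "real \<Rightarrow> (real ^ 'd \<Rightarrow> real) \<Rightarrow> (real ^ 'd \<Rightarrow> real) \<Rightarrow> ennreal" where
  "wnorm p \<sigma> f = (\<integral>\<^sup>+x. ennreal (\<bar>f x\<bar> powr p * \<sigma> x) \<partial>lebesgue) epowr (1 / p)"

definition cubes :: "(real ^ 'd) set set" where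
  "cubes = {cbox a (a + vec l) | a l. 0 < l}"

definition average :: "(real ^ 'd \<Rightarrow> ennreal) \<Rightarrow> (real ^ 'd) set \<Rightarrow> ennreal" where
  "average g Q = (\<integral>\<^sup>+x\<in>Q. g x \<partial>lebesgue) / emeasure lebesgue Q"

definition Ap_const :: "real \<Rightarrow> (real ^ 'd \<Rightarrow> real) \<Rightarrow> ennreal" where
  "Ap_const p w =
     (SUP Q\<in>cubes. average (\<lambda>x. ennreal (w x)) Q *
        average (\<lambda>x. ennreal (w x) epowr (- 1 / (p - 1))) Q epowr (p - 1))"

(* Ap_const p w is nonincreasing in p > 1, so the limit always exists in [0,\<infinity>]. *)
definition A_infty :: "(real ^ 'd \<Rightarrow> real) \<Rightarrow> bool" where
  "A_infty w \<longleftrightarrow> weight w \<and> (\<exists>L<top. ((\<lambda>p. Ap_const p w) \<longlongrightarrow> L) at_top)"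

definition A0_weights where
  "A0_weights n r p \<sigma> K \<S> E =
     (\<Sum>\<^sub>\<infinity>S\<in>\<S>.
        (ennreal (K S) * emeasure lebesgue S ^ (n - 1) *
           (\<Prod>i=1..n. (wmeasure (\<sigma> i) S / emeasure lebesgue S) epowr (1 / conj_exp (p i)))) epowr r *
        emeasure lebesgue (E S)) epowr (1 / r)"
  for n :: nat and r :: real and p :: "nat \<Rightarrow> real" and \<sigma> :: "nat \<Rightarrow> real ^ 'd \<Rightarrow> real"
    and K :: "(real ^ 'd) set \<Rightarrow> real"

definition A0_bump where
  "A0_bump \<theta> n r p \<sigma> K \<S> E =
     (\<Sum>\<^sub>\<infinity>S\<in>\<S>.
        (ennreal (K S) * emeasure lebesgue S ^ (n - 1) *
           (\<Prod>i=1..n. (wmeasure (\<lambda>x. \<sigma> i x powr \<theta>) S / emeasure lebesgue S)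
              epowr (1 / (\<theta> * conj_exp (p i))))) epowr r *
        emeasure lebesgue (E S)) epowr (1 / r)"
  for n :: nat and r :: real and p :: "nat \<Rightarrow> real" and \<sigma> :: "nat \<Rightarrow> real ^ 'd \<Rightarrow> real"
    and K :: "(real ^ 'd) set \<Rightarrow> real"

definition multilinear_embedding where
  "multilinear_embedding n p \<sigma> K \<S> f C \<longleftrightarrow>
     (\<Sum>\<^sub>\<infinity>S\<in>\<S>. ennreal (K S) * (\<Prod>i=1..n. \<integral>\<^sup>+x\<in>S. ennreal (f i x * \<sigma> i x) \<partial>lebesgue))
       \<le> C * (\<Prod>i=1..n. wnorm (p i) (\<sigma> i) (f i))"
  for n :: nat and p :: "nat \<Rightarrow> real" and \<sigma> f :: "nat \<Rightarrow> real ^ 'd \<Rightarrow> real"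
    and K :: "(real ^ 'd) set \<Rightarrow> real"

end

(* Both cases factor each term of the sum, up to a constant, as X_S * Y_{1,S} * ... * Y_{n,S}, where
   the l^r norm of X is A_0 and the l^{p_i} norm of Y_i is controlled by the norm of f_i; Hoelder's
   inequality with exponents r, p_1, ..., p_n then gives the claim.

   (a) A_infinity and sparseness give sigma_i(S) <= D sigma_i(E(S)). Let Y_{i,S} be
   sigma_i(S)^{1/p_i} times the sigma_i-average of f_i over S.
   (b) Let q_i = p_i - (p_i - 1)/theta > 1. Hoelder's inequality on S with exponents p_i/q_i and
   theta p_i' splits off the bumped average of sigma_i and leaves the Lebesgue average a_{i,S} of
   (f_i^{p_i} sigma_i)^{1/q_i}; let Y_{i,S} = a_{i,S}^{q_i/p_i} |E(S)|^{1/p_i}.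

   In both cases the bound on Y_i is the dyadic Carleson embedding
   sum_S mu(E(S)) <h>_S^q <= C_q int h^q dmu, with mu = sigma_i or Lebesgue measure. It holds for
   every family of nested sets: group the S with <h>_S between 2^{j+1} and 2^{j+2}, bound the
   measure of their union by 2^{-j} int_{h >= 2^j} h through the maximal sets, and sum over j. *)
theory Submission
  imports Defs
begin

section \<open>Powers and Hoelder's inequality on the extended nonnegative reals\<close>

lemma epowr_ennreal: "0 < a \<Longrightarrow> 0 \<le> x \<Longrightarrow> ennreal x epowr a = ennreal (x powr a)"
  by (auto simp: epowr_def)

lemma epowr_top [simp]: "0 < a \<Longrightarrow> top epowr a = top"
  by (simp add: epowr_def)

lemma zero_epowr [simp]: "0 < a \<Longrightarrow> 0 epowr a = 0"
  by (simp add: epowr_def)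

lemma epowr_1 [simp]: "x epowr 1 = x"
  by (cases x) (auto simp: epowr_ennreal)

lemma epowr_eq_0_iff: "0 < a \<Longrightarrow> x epowr a = 0 \<longleftrightarrow> x = 0"
  by (cases x) (auto simp: epowr_ennreal)

lemma epowr_less_top_iff: "0 < a \<Longrightarrow> x epowr a < top \<longleftrightarrow> x < top"
  by (cases x) (auto simp: epowr_ennreal)

text \<open>A positive power fixes 0 and \<open>top\<close>, so both sides also agree under the
  convention 0 * \<open>top\<close> = 0.\<close>

lemma epowr_mult: "0 < a \<Longrightarrow> (x * y) epowr a = x epowr a * y epowr a"
  by (cases x; cases y)
    (auto simp: epowr_ennreal powr_mult ennreal_mult_top ennreal_top_mult epowr_eq_0_iff
      simp flip: ennreal_mult)

lemma epowr_add: "0 < a \<Longrightarrow> 0 < b \<Longrightarrow> x epowr (a + b) = x epowr a * x epowr b"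
  by (cases x) (auto simp: epowr_ennreal powr_add simp flip: ennreal_mult)

lemma epowr_epowr: "0 < a \<Longrightarrow> 0 < b \<Longrightarrow> (x epowr a) epowr b = x epowr (a * b)"
  by (cases x) (auto simp: epowr_ennreal powr_powr)

lemma epowr_mono: "0 < a \<Longrightarrow> x \<le> y \<Longrightarrow> x epowr a \<le> y epowr a"
  by (cases x; cases y) (auto simp: epowr_ennreal top_unique intro!: ennreal_leI powr_mono2)

lemma epowr_sum:
  assumes "finite I" "I \<noteq> {}" "\<And>i. i \<in> I \<Longrightarrow> 0 < a i"
  shows "x epowr (\<Sum>i\<in>I. a i) = (\<Prod>i\<in>I. x epowr a i)"
  using assms
  by (induction I rule: finite_ne_induct) (auto simp: epowr_add sum_pos)

lemma borel_measurable_epowr [measurable]: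
  assumes [measurable]: "f \<in> borel_measurable M"
  shows "(\<lambda>x. f x epowr a) \<in> borel_measurable M"
proof -
  have [measurable]: "{x \<in> space M. f x = c} \<in> sets M" for c
    by measurable
  have [measurable]: "(\<lambda>x. enn2real (f x) powr a) \<in> borel_measurable M"
    by measurable
  show ?thesis
    unfolding epowr_def by (intro measurable_If borel_measurable_const) simp_all
qed

text \<open>Weighted AM-GM is Jensen's inequality for \<open>exp\<close> at the points
  \<open>ln (u i)\<close>. The values 0 and \<open>top\<close> are split off first because
  \<open>ln\<close> needs positive reals; a zero factor wins over an infinite one since 0 *
  \<open>top\<close> = 0.\<close>

lemma ennreal_amgm:
  fixes x :: "'i \<Rightarrow> ennreal"
  assumes I: "finite I" and a: "\<And>i. i \<in> I \<Longrightarrow> 0 < a i" "(\<Sum>i\<in>I. a i) = 1"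
  shows "(\<Prod>i\<in>I. x i epowr a i) \<le> (\<Sum>i\<in>I. ennreal (a i) * x i)"
proof -
  have ne: "I \<noteq> {}" using a(2) by auto
  consider (zero) "\<exists>i\<in>I. x i = 0" | (top) "\<exists>i\<in>I. x i = top" | (fin) "\<forall>i\<in>I. x i \<noteq> 0 \<and> x i \<noteq> top"
    by blast
  then show ?thesis
  proof cases
    case zero
    then have "(\<Prod>i\<in>I. x i epowr a i) = 0"
      using I a by (intro prod_zero) force+
    then show ?thesis by (simp only: zero_le)
  next
    case top
    then obtain j where j: "j \<in> I" "x j = top" by blast
    have "(\<Sum>i\<in>I. ennreal (a i) * x i) = top"
      using I j a(1)[of j] by (auto simp: sum.remove[of I j] ennreal_mult_top)
    then show ?thesis by simp
  next
    case fin
    define u where "u i = enn2real (x i)" for i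
    have u: "0 < u i" "x i = ennreal (u i)" if "i \<in> I" for i
      using fin that unfolding u_def
      by (auto simp: enn2real_positive_iff less_top zero_less_iff_neq_zero)
    have "(\<Prod>i\<in>I. u i powr a i) = exp (\<Sum>i\<in>I. a i *\<^sub>R ln (u i))"
      unfolding exp_sum[OF I] using u(1)
      by (intro prod.cong refl) (simp add: powr_def less_imp_neq[symmetric])
    also have "\<dots> \<le> (\<Sum>i\<in>I. a i * exp (ln (u i)))"
      by (rule convex_on_sum[OF I ne, where C = UNIV])
        (use a in \<open>auto simp: exp_convex less_imp_le\<close>)
    also have "\<dots> = (\<Sum>i\<in>I. a i * u i)"
      using u(1) by (intro sum.cong) auto
    finally have *: "(\<Prod>i\<in>I. u i powr a i) \<le> (\<Sum>i\<in>I. a i * u i)" .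
    have "(\<Prod>i\<in>I. x i epowr a i) = (\<Prod>i\<in>I. ennreal (u i powr a i))"
      using u a(1) by (intro prod.cong) (auto simp: epowr_ennreal less_imp_le)
    also have "\<dots> = ennreal (\<Prod>i\<in>I. u i powr a i)"
      by (rule prod_ennreal) simp
    also have "\<dots> \<le> ennreal (\<Sum>i\<in>I. a i * u i)"
      by (rule ennreal_leI[OF *])
    also have "\<dots> = (\<Sum>i\<in>I. ennreal (a i * u i))"
      using u(1) a(1) by (subst sum_ennreal) (auto simp: less_imp_le)
    also have "\<dots> = (\<Sum>i\<in>I. ennreal (a i) * x i)"
      using u a(1) by (intro sum.cong) (auto simp: ennreal_mult less_imp_le)
    finally show ?thesis .
  qed
qed

text \<open>Hoelder's inequality for finitely many functions: divide each \<open>u i\<close> by its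
  integral \<open>N i\<close>, apply AM-GM pointwise and integrate, which leaves the sum of the
  \<open>a i\<close>. A vanishing \<open>N i\<close> is treated before an infinite one because it
  makes the right-hand side 0; the integrand then vanishes almost everywhere.\<close>

lemma nn_integral_prod_epowr_le:
  fixes u :: "'i \<Rightarrow> 'a \<Rightarrow> ennreal"
  assumes I: "finite I" and a: "\<And>i. i \<in> I \<Longrightarrow> 0 < a i" "(\<Sum>i\<in>I. a i) = 1"
    and u [measurable]: "\<And>i. i \<in> I \<Longrightarrow> u i \<in> borel_measurable M"
  shows "(\<integral>\<^sup>+x. (\<Prod>i\<in>I. u i x epowr a i) \<partial>M) \<le> (\<Prod>i\<in>I. (\<integral>\<^sup>+x. u i x \<partial>M) epowr a i)"
proof -
  define N where "N i = (\<integral>\<^sup>+x. u i x \<partial>M)" for i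
  consider (zero) "\<exists>i\<in>I. N i = 0" | (top) "\<forall>i\<in>I. N i \<noteq> 0" "\<exists>i\<in>I. N i = top"
    | (fin) "\<forall>i\<in>I. N i \<noteq> 0 \<and> N i \<noteq> top"
    by blast
  then show ?thesis
  proof cases
    case zero
    then obtain j where j: "j \<in> I" "N j = 0" by blast
    then have "AE x in M. u j x = 0"
      unfolding N_def by (subst (asm) nn_integral_0_iff_AE) auto
    then have "AE x in M. (\<Prod>i\<in>I. u i x epowr a i) = 0"
    proof eventually_elim
      case (elim x)
      then show ?case using j I a by (intro prod_zero) force+
    qed
    then have "(\<integral>\<^sup>+x. (\<Prod>i\<in>I. u i x epowr a i) \<partial>M) = 0"
      by (subst nn_integral_0_iff_AE) auto
    then show ?thesis by simp
  next
    case top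
    then obtain j where j: "j \<in> I" "N j = top" by blast
    have "(\<Prod>i\<in>I. N i epowr a i) = top"
      using I j a top(1)
      by (simp add: prod.remove[of I j] ennreal_top_mult epowr_eq_0_iff)
    then show ?thesis unfolding N_def by simp
  next
    case fin
    have split: "u i x epowr a i = N i epowr a i * (u i x / N i) epowr a i" if "i \<in> I" for i x
    proof -
      have "u i x = N i * (u i x / N i)"
        using fin that by (simp add: ennreal_times_divide mult.commute[of "N i"] mult_divide_eq_ennreal)
      then show ?thesis using epowr_mult[OF a(1)[OF that], of "N i" "u i x / N i"] by simp
    qed
    have "(\<integral>\<^sup>+x. (\<Prod>i\<in>I. (u i x / N i) epowr a i) \<partial>M)
        \<le> (\<integral>\<^sup>+x. (\<Sum>i\<in>I. ennreal (a i) * (u i x / N i)) \<partial>M)"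
      by (intro nn_integral_mono ennreal_amgm I a)
    also have "\<dots> = (\<Sum>i\<in>I. ennreal (a i) * (N i / N i))"
      by (simp add: nn_integral_sum nn_integral_cmult nn_integral_divide N_def)
    also have "\<dots> = (\<Sum>i\<in>I. ennreal (a i))"
      using fin by (intro sum.cong) (auto simp: ennreal_divide_self less_top)
    also have "\<dots> = 1"
      using a by (subst sum_ennreal) (auto simp: less_imp_le)
    finally have le1: "(\<integral>\<^sup>+x. (\<Prod>i\<in>I. (u i x / N i) epowr a i) \<partial>M) \<le> 1" .
    have "(\<integral>\<^sup>+x. (\<Prod>i\<in>I. u i x epowr a i) \<partial>M)
        = (\<integral>\<^sup>+x. (\<Prod>i\<in>I. N i epowr a i) * (\<Prod>i\<in>I. (u i x / N i) epowr a i) \<partial>M)"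
      by (simp add: split flip: prod.distrib cong: prod.cong)
    also have "\<dots> = (\<Prod>i\<in>I. N i epowr a i) * (\<integral>\<^sup>+x. (\<Prod>i\<in>I. (u i x / N i) epowr a i) \<partial>M)"
      by (rule nn_integral_cmult) measurable
    also have "\<dots> \<le> (\<Prod>i\<in>I. N i epowr a i) * 1"
      by (rule mult_left_mono[OF le1]) simp
    finally show ?thesis
      by (simp only: N_def mult_1_right)
  qed
qed

text \<open>Hoelder's inequality for the counting measure on \<open>F\<close>.\<close>

lemma sum_prod_epowr_le:
  fixes u :: "'i \<Rightarrow> 'a \<Rightarrow> ennreal"
  assumes "finite I" "\<And>i. i \<in> I \<Longrightarrow> 0 < a i" "(\<Sum>i\<in>I. a i) = 1" "finite F"
  shows "(\<Sum>x\<in>F. \<Prod>i\<in>I. u i x epowr a i) \<le> (\<Prod>i\<in>I. (\<Sum>x\<in>F. u i x) epowr a i)"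
proof -
  have "(\<integral>\<^sup>+x. (\<Prod>i\<in>I. u i x epowr a i) \<partial>count_space F)
    \<le> (\<Prod>i\<in>I. (\<integral>\<^sup>+x. u i x \<partial>count_space F) epowr a i)"
    by (rule nn_integral_prod_epowr_le[OF assms(1-3)]) auto
  then show ?thesis by (simp only: nn_integral_count_space_finite[OF assms(4)])
qed

lemma nn_integral_mult_epowr_le:
  fixes f g :: "'a \<Rightarrow> ennreal"
  assumes "0 < a" "0 < b" "a + b = 1"
    and "f \<in> borel_measurable M" "g \<in> borel_measurable M"
  shows "(\<integral>\<^sup>+x. f x epowr a * g x epowr b \<partial>M)
    \<le> (\<integral>\<^sup>+x. f x \<partial>M) epowr a * (\<integral>\<^sup>+x. g x \<partial>M) epowr b"
proof -
  \<comment> \<open>The index type \<open>bool\<close> turns the general inequality into the one for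
    two functions.\<close>
  define u where "u i = (if i then f else g)" for i
  define c where "c i = (if i then a else b)" for i
  have "(\<integral>\<^sup>+x. (\<Prod>i\<in>UNIV. u i x epowr c i) \<partial>M) \<le> (\<Prod>i\<in>UNIV. (\<integral>\<^sup>+x. u i x \<partial>M) epowr c i)"
  proof (rule nn_integral_prod_epowr_le)
    show "0 < c i" for i using assms(1,2) by (simp add: c_def)
    show "(\<Sum>i\<in>UNIV. c i) = 1" using assms(3) by (simp add: UNIV_bool c_def)
    show "u i \<in> borel_measurable M" for i using assms(4,5) by (simp add: u_def)
  qed simp
  then show ?thesis by (simp add: UNIV_bool u_def c_def mult.commute)
qed

section \<open>The Carleson embedding for nested families\<close>

text \<open>Counted down from the largest exponent \<open>m\<close>, the terms belong to a geometric
  series with ratio \<open>2 powr - s\<close>, whose leading term is at most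
  \<open>t powr s\<close>.\<close>

lemma sum_powr_below_le:
  fixes s t :: real and A :: "int set"
  assumes s: "0 < s" and A: "finite A" "\<And>k. k \<in> A \<Longrightarrow> 2 powr of_int k \<le> t"
  shows "(\<Sum>k\<in>A. (2 powr of_int k) powr s) \<le> t powr s / (1 - 2 powr - s)"
proof (cases "A = {}")
  case True
  have "2 powr - s < (1::real)" using powr_less_mono[of "- s" 0 2] s by simp
  then show ?thesis using True by simp
next
  case False
  define m where "m = Max A"
  define b where "b = 2 powr - s"
  have b: "0 < b" "b < 1" using powr_less_mono[of "- s" 0 2] s by (auto simp: b_def)
  have m: "m \<in> A" using A False by (simp add: m_def)
  have le: "k \<le> m" if "k \<in> A" for k using A that by (simp add: m_def)
  have inj: "inj_on (\<lambda>k. nat (m - k)) A"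
  proof (rule inj_onI)
    fix x y assume "x \<in> A" "y \<in> A" "nat (m - x) = nat (m - y)"
    then show "x = y" using le[of x] le[of y] by simp
  qed
  have "(\<Sum>k\<in>A. (2 powr of_int k) powr s) = (\<Sum>k\<in>A. (2 powr of_int m) powr s * b ^ nat (m - k))"
  proof (rule sum.cong[OF refl])
    fix k assume "k \<in> A"
    from le[OF this] have "b ^ nat (m - k) = 2 powr (- s * of_int (m - k))"
      by (simp add: b_def powr_powr flip: powr_realpow)
    then show "(2 powr of_int k) powr s = (2 powr of_int m) powr s * b ^ nat (m - k)"
      by (simp add: powr_powr algebra_simps flip: powr_add)
  qed
  also have "\<dots> = (2 powr of_int m) powr s * (\<Sum>j\<in>(\<lambda>k. nat (m - k)) ` A. b ^ j)"
    by (simp add: sum.reindex[OF inj] sum_distrib_left)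
  also have "\<dots> \<le> (2 powr of_int m) powr s * (1 / (1 - b))"
  proof (rule mult_left_mono)
    have "(\<Sum>j\<in>(\<lambda>k. nat (m - k)) ` A. b ^ j) \<le> (\<Sum>j. b ^ j)"
      by (rule sum_le_suminf) (use A b in \<open>auto intro: summable_geometric\<close>)
    then show "(\<Sum>j\<in>(\<lambda>k. nat (m - k)) ` A. b ^ j) \<le> 1 / (1 - b)"
      using b by (simp add: suminf_geometric)
  qed simp
  also have "\<dots> \<le> t powr s * (1 / (1 - b))"
    by (intro mult_right_mono powr_mono2) (use A m s b in auto)
  finally show ?thesis by (simp add: b_def)
qed

text \<open>The inclusion-maximal members of \<open>G\<close> cover the same set and are pairwise
  disjoint, so their local bounds add up to at most one integral of \<open>g\<close>. Applied to
  truncations of a function, this is the weak-type bound for the maximal function of a nested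
  family.\<close>

lemma emeasure_Union_nested_le:
  fixes g :: "'a \<Rightarrow> ennreal"
  assumes G: "finite G" "G \<subseteq> sets M"
    and nested: "\<And>S T. S \<in> G \<Longrightarrow> T \<in> G \<Longrightarrow> S \<inter> T = {} \<or> S \<subseteq> T \<or> T \<subseteq> S"
    and g [measurable]: "g \<in> borel_measurable M"
    and le: "\<And>S. S \<in> G \<Longrightarrow> c * emeasure M S \<le> (\<integral>\<^sup>+x\<in>S. g x \<partial>M)"
  shows "c * emeasure M (\<Union>G) \<le> (\<integral>\<^sup>+x. g x \<partial>M)"
proof -
  define G' where "G' = {S\<in>G. \<forall>T\<in>G. S \<subseteq> T \<longrightarrow> S = T}"
  have G': "finite G'" "G' \<subseteq> sets M" using G by (auto simp: G'_def)
  have "\<exists>T\<in>G'. S \<subseteq> T" if "S \<in> G" for S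
    using finite_has_maximal2[OF G(1) that] unfolding G'_def by auto
  then have U: "\<Union>G = \<Union>G'" unfolding G'_def by blast
  have disj: "disjoint_family_on (\<lambda>S. S) G'"
    unfolding disjoint_family_on_def
  proof (intro ballI impI)
    fix S T assume "S \<in> G'" "T \<in> G'" "S \<noteq> T"
    then show "S \<inter> T = {}" using nested[of S T] by (auto simp: G'_def)
  qed
  have "c * emeasure M (\<Union>G) \<le> c * (\<Sum>S\<in>G'. emeasure M S)"
    unfolding U using emeasure_subadditive_finite[OF G'(1), of "\<lambda>S. S" M] G'(2)
    by (intro mult_left_mono) auto
  also have "\<dots> \<le> (\<Sum>S\<in>G'. \<integral>\<^sup>+x\<in>S. g x \<partial>M)"
    unfolding sum_distrib_left by (intro sum_mono le) (auto simp: G'_def)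
  also have "\<dots> = (\<integral>\<^sup>+x. (\<Sum>S\<in>G'. g x * indicator S x) \<partial>M)"
    using G'(2) by (intro nn_integral_sum[symmetric]) auto
  also have "\<dots> = (\<integral>\<^sup>+x. g x * indicator (\<Union>S\<in>G'. S) x \<partial>M)"
    by (simp only: indicator_UN_disjoint[OF G'(1) disj] sum_distrib_left)
  also have "\<dots> \<le> (\<integral>\<^sup>+x. g x \<partial>M)"
    by (intro nn_integral_mono) (auto split: split_indicator)
  finally show ?thesis .
qed

text \<open>The factor \<open>4 powr q\<close> is the loss from \<open>a S \<le> 4 * v j\<close> on
  the level \<open>j\<close>; the denominator comes from the geometric series over the levels, with
  ratio \<open>2 powr (1 - q)\<close>.\<close>

definition carleson_const :: "real \<Rightarrow> real" where
  "carleson_const q = 4 powr q / (1 - 2 powr (1 - q))"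

lemma carleson_const_pos: "1 < q \<Longrightarrow> 0 < carleson_const q"
  using powr_less_mono[of "1 - q" 0 2] by (simp add: carleson_const_def)

lemma ennreal_dyadic_scale:
  assumes "0 < x" "x < (top :: ennreal)"
  obtains k :: int where "ennreal (2 * 2 powr of_int k) \<le> x" "x \<le> ennreal (4 * 2 powr of_int k)"
proof -
  obtain t where t: "x = ennreal t" "0 < t"
    using assms by (cases x) auto
  \<comment> \<open>The shift by 1 makes \<open>2 powr k\<close> at most half of \<open>x\<close>;
    this slack absorbs the small values of \<open>h\<close> in the Carleson embedding.\<close>
  define k where "k = \<lfloor>log 2 t\<rfloor> - 1"
  have 1: "2 powr (of_int k + 1) \<le> 2 powr log 2 t" "2 powr log 2 t \<le> 2 powr (of_int k + 2)"
    unfolding k_def by (auto intro!: powr_mono) linarith+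
  show ?thesis
    by (rule that[of k]) (use 1 t in \<open>auto intro!: ennreal_leI simp: powr_add mult.commute\<close>)
qed

text \<open>\<open>a S\<close> plays the average of \<open>h\<close> over \<open>S\<close>. The
  product form of the assumption leaves it arbitrary on null sets, where \<open>E S\<close> is null
  too and the term vanishes. The estimate is a weak-type bound on each dyadic level of
  \<open>a\<close>, summed over the levels inside the integral.\<close>

lemma carleson_embedding:
  fixes h :: "'a \<Rightarrow> ennreal" and a :: "'a set \<Rightarrow> ennreal"
  assumes q: "1 < q"
    and F: "finite F" "F \<subseteq> sets M" "\<And>S. S \<in> F \<Longrightarrow> emeasure M S < top"
    and nested: "\<And>S T. S \<in> F \<Longrightarrow> T \<in> F \<Longrightarrow> S \<inter> T = {} \<or> S \<subseteq> T \<or> T \<subseteq> S"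
    and E: "\<And>S. S \<in> F \<Longrightarrow> E S \<in> sets M" "\<And>S. S \<in> F \<Longrightarrow> E S \<subseteq> S" "disjoint_family_on E F"
    and h [measurable]: "h \<in> borel_measurable M"
    and a: "\<And>S. S \<in> F \<Longrightarrow> a S * emeasure M S \<le> (\<integral>\<^sup>+x\<in>S. h x \<partial>M)"
  shows "(\<Sum>S\<in>F. emeasure M (E S) * a S epowr q)
    \<le> ennreal (carleson_const q) * (\<integral>\<^sup>+x. h x epowr q \<partial>M)"
proof (cases "(\<integral>\<^sup>+x. h x epowr q \<partial>M) = top")
  case True
  then show ?thesis using carleson_const_pos[OF q] by (simp add: ennreal_mult_top)
next
  case fin: False
  \<comment> \<open>The discarded terms are 0. On the remaining sets \<open>a S\<close> is nonzero
    and, once shown to be finite, has a dyadic level.\<close>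
  define F' where "F' = {S\<in>F. emeasure M S \<noteq> 0 \<and> a S \<noteq> 0}"
  have F': "finite F'" "F' \<subseteq> F" using F(1) by (auto simp: F'_def)
  \<comment> \<open>With this bound, finiteness of the integral of \<open>h epowr q\<close> and of
    the measure of \<open>S\<close> makes the integral of \<open>h\<close> over \<open>S\<close>
    finite, hence \<open>a S < top\<close>.\<close>
  have le_powr: "u \<le> 1 + u epowr q" for u
  proof (cases u)
    case (real t)
    have "t \<le> 1 + t powr q"
    proof (cases "t \<le> 1")
      case False
      then have "t powr 1 \<le> t powr q" using q by (intro powr_mono) auto
      then show ?thesis using False by simp
    qed (use real in \<open>smt (verit) powr_ge_zero\<close>)
    then have "ennreal t \<le> ennreal (1 + t powr q)" by (rule ennreal_leI)
    then show ?thesis using real q by (simp add: epowr_ennreal)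
  qed (use q in simp)
  have afin: "a S < top" if "S \<in> F'" for S
  proof -
    have S [measurable]: "S \<in> sets M" and SF: "S \<in> F" using that F by (auto simp: F'_def)
    have "a S * emeasure M S \<le> (\<integral>\<^sup>+x. indicator S x + h x epowr q \<partial>M)"
      using le_powr by (intro order_trans[OF a[OF SF]] nn_integral_mono) (auto split: split_indicator)
    also have "\<dots> = emeasure M S + (\<integral>\<^sup>+x. h x epowr q \<partial>M)"
      by (subst nn_integral_add) auto
    also have "\<dots> < top" using F(3)[OF SF] fin by (simp add: less_top)
    finally show ?thesis using that
      by (cases "a S = top") (auto simp: F'_def less_top ennreal_top_mult)
  qed
  define v where "v j = (2::real) powr of_int j" for j :: int
  have v: "0 < v j" for j by (simp add: v_def)
  have "\<forall>S\<in>F'. \<exists>j. ennreal (2 * v j) \<le> a S \<and> a S \<le> ennreal (4 * v j)"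
  proof
    fix S assume "S \<in> F'"
    then show "\<exists>j. ennreal (2 * v j) \<le> a S \<and> a S \<le> ennreal (4 * v j)"
      using ennreal_dyadic_scale[of "a S"] afin unfolding v_def F'_def
      by (metis (mono_tags, lifting) mem_Collect_eq zero_less_iff_neq_zero)
  qed
  then obtain J where J: "\<And>S. S \<in> F' \<Longrightarrow> ennreal (2 * v (J S)) \<le> a S"
    "\<And>S. S \<in> F' \<Longrightarrow> a S \<le> ennreal (4 * v (J S))"
    by metis
  define G where "G j = {S\<in>F'. J S = j}" for j
  have G: "finite (G j)" "G j \<subseteq> F'" "G j \<subseteq> F" "G j \<subseteq> sets M" for j
    using F' F(2) by (auto simp: G_def)
  define cut where "cut j x = h x * indicator {x\<in>space M. ennreal (v j) \<le> h x} x" for j x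
  have cut_meas [measurable]: "cut j \<in> borel_measurable M" for j
    unfolding cut_def by measurable
  have weak: "ennreal (v j) * (\<Sum>S\<in>G j. emeasure M (E S)) \<le> (\<integral>\<^sup>+x. cut j x \<partial>M)" for j
  proof -
    have "ennreal (v j) * emeasure M (\<Union>(G j)) \<le> (\<integral>\<^sup>+x. cut j x \<partial>M)"
    proof (rule emeasure_Union_nested_le[OF G(1,4)])
      show "S \<inter> T = {} \<or> S \<subseteq> T \<or> T \<subseteq> S" if "S \<in> G j" "T \<in> G j" for S T
        using nested[of S T] that G(3)[of j] by auto
      fix S assume S: "S \<in> G j"
      then have [measurable]: "S \<in> sets M" and SF: "S \<in> F" "S \<in> F'" using G[of j] by auto
      \<comment> \<open>The average of \<open>h\<close> over \<open>S\<close> is at least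
        \<open>2 * v j\<close>, while the values of \<open>h\<close> below \<open>v j\<close>
        account for at most \<open>v j\<close> times the measure of \<open>S\<close>. Cancelling
        this finite amount leaves the other half to \<open>cut j\<close>.\<close>
      have "ennreal (v j) * emeasure M S + ennreal (v j) * emeasure M S
          = ennreal (2 * v j) * emeasure M S"
        by (simp add: distrib_right[symmetric] ennreal_plus[symmetric] v less_imp_le del: ennreal_plus)
      also have "\<dots> \<le> a S * emeasure M S"
        using J(1)[OF SF(2)] S by (intro mult_right_mono) (auto simp: G_def)
      also have "\<dots> \<le> (\<integral>\<^sup>+x\<in>S. h x \<partial>M)" by (rule a[OF SF(1)])
      also have "\<dots> \<le> (\<integral>\<^sup>+x. ennreal (v j) * indicator S x + cut j x * indicator S x \<partial>M)"
        by (intro nn_integral_mono) (auto simp: cut_def split: split_indicator)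
      also have "\<dots> = ennreal (v j) * emeasure M S + (\<integral>\<^sup>+x\<in>S. cut j x \<partial>M)"
        by (subst nn_integral_add) (auto simp: nn_integral_cmult)
      finally show "ennreal (v j) * emeasure M S \<le> (\<integral>\<^sup>+x\<in>S. cut j x \<partial>M)"
        using F(3)[OF SF(1)] by (subst (asm) ennreal_add_left_cancel_le) (auto simp: ennreal_mult_eq_top_iff)
    qed measurable
    moreover have "(\<Sum>S\<in>G j. emeasure M (E S)) = emeasure M (\<Union>S\<in>G j. E S)"
      using G[of j] E(1) by (intro sum_emeasure disjoint_family_on_mono[OF G(3) E(3)]) blast+
    moreover have "emeasure M (\<Union>S\<in>G j. E S) \<le> emeasure M (\<Union>(G j))"
    proof (rule emeasure_mono)
      show "(\<Union>S\<in>G j. E S) \<subseteq> \<Union>(G j)" using G(3)[of j] E(2) by blast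
      show "\<Union>(G j) \<in> sets M" using G[of j] by (intro sets.finite_Union) auto
    qed
    ultimately show ?thesis
      using mult_left_mono[of "\<Sum>S\<in>G j. emeasure M (E S)" "emeasure M (\<Union>(G j))" "ennreal (v j)"]
      by simp
  qed
  \<comment> \<open>At \<open>x\<close> only the levels with \<open>v j \<le> h x\<close>
    contribute. The geometric sum of \<open>v j powr (q - 1)\<close> over them is at most a multiple
    of the power q - 1 of \<open>h x\<close>, and the factor \<open>h x\<close> in
    \<open>cut j x\<close> completes the power \<open>q\<close>.\<close>
  have pt: "(\<Sum>j\<in>J ` F'. ennreal (4 powr q * v j powr (q - 1)) * cut j x)
      \<le> ennreal (carleson_const q) * h x epowr q" if x: "x \<in> space M" for x
  proof (cases "h x")
    case top
    then show ?thesis using carleson_const_pos[OF q] q by (simp add: ennreal_mult_top)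
  next
    case (real t)
    define A where "A = {j\<in>J ` F'. v j \<le> t}"
    have A: "finite A" "A \<subseteq> J ` F'" using F'(1) by (auto simp: A_def)
    have "(\<Sum>j\<in>J ` F'. ennreal (4 powr q * v j powr (q - 1)) * cut j x)
        = (\<Sum>j\<in>A. ennreal (4 powr q * v j powr (q - 1)) * ennreal t)"
      by (rule sum.mono_neutral_cong_right)
        (use F'(1) x real in \<open>auto simp: A_def cut_def split: split_indicator\<close>)
    also have "\<dots> = ennreal (4 powr q * t * (\<Sum>j\<in>A. v j powr (q - 1)))"
      using real by (simp add: sum_distrib_left sum_nonneg mult_ac flip: ennreal_mult sum_ennreal)
    also have "\<dots> \<le> ennreal (4 powr q * t * (t powr (q - 1) / (1 - 2 powr - (q - 1))))"
      unfolding v_def using real q A(1)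
      by (intro ennreal_leI mult_left_mono sum_powr_below_le) (auto simp: A_def v_def)
    also have "4 powr q * t * (t powr (q - 1) / (1 - 2 powr - (q - 1))) = carleson_const q * t powr q"
      using real by (cases "t = 0") (auto simp: carleson_const_def powr_diff)
    also have "ennreal (carleson_const q * t powr q) = ennreal (carleson_const q) * h x epowr q"
      using real q carleson_const_pos[OF q] by (simp add: epowr_ennreal ennreal_mult)
    finally show ?thesis .
  qed
  have "(\<Sum>S\<in>F. emeasure M (E S) * a S epowr q) = (\<Sum>S\<in>F'. emeasure M (E S) * a S epowr q)"
  proof (rule sum.mono_neutral_right[OF F(1) F'(2)], rule ballI)
    fix S assume S: "S \<in> F - F'"
    then have "emeasure M (E S) \<le> emeasure M S"
      using E(2)[of S] F(2) by (intro emeasure_mono) auto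
    then show "emeasure M (E S) * a S epowr q = 0"
      using S q by (auto simp: F'_def)
  qed
  also have "\<dots> \<le> (\<Sum>S\<in>F'. emeasure M (E S) * ennreal (4 * v (J S)) epowr q)"
    by (intro sum_mono mult_left_mono epowr_mono J(2)) (use q in auto)
  also have "\<dots> = (\<Sum>j\<in>J ` F'. \<Sum>S\<in>G j. emeasure M (E S) * ennreal (4 * v (J S)) epowr q)"
    unfolding G_def by (rule sum.image_gen[OF F'(1)])
  also have "\<dots> = (\<Sum>j\<in>J ` F'. ennreal (4 powr q * v j powr (q - 1)) *
      (ennreal (v j) * (\<Sum>S\<in>G j. emeasure M (E S))))"
  proof (rule sum.cong[OF refl])
    fix j
    \<comment> \<open>One factor \<open>v j\<close> is split off for the weak-type bound; the
      remaining exponent q - 1 is positive, so the levels sum geometrically.\<close>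
    have "ennreal (v j * 4) epowr q = ennreal (4 powr q * v j powr (q - 1)) * ennreal (v j)"
      using v[of j] q by (simp add: epowr_ennreal powr_mult powr_diff flip: ennreal_mult)
    then show "(\<Sum>S\<in>G j. emeasure M (E S) * ennreal (4 * v (J S)) epowr q)
      = ennreal (4 powr q * v j powr (q - 1)) * (ennreal (v j) * (\<Sum>S\<in>G j. emeasure M (E S)))"
      unfolding sum_distrib_left by (intro sum.cong) (auto simp: G_def mult_ac)
  qed
  also have "\<dots> \<le> (\<Sum>j\<in>J ` F'. ennreal (4 powr q * v j powr (q - 1)) * (\<integral>\<^sup>+x. cut j x \<partial>M))"
    by (intro sum_mono mult_left_mono weak) auto
  also have "\<dots> = (\<integral>\<^sup>+x. (\<Sum>j\<in>J ` F'. ennreal (4 powr q * v j powr (q - 1)) * cut j x) \<partial>M)"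
    by (simp add: nn_integral_sum nn_integral_cmult)
  also have "\<dots> \<le> (\<integral>\<^sup>+x. ennreal (carleson_const q) * h x epowr q \<partial>M)"
    by (intro nn_integral_mono pt)
  also have "\<dots> = ennreal (carleson_const q) * (\<integral>\<^sup>+x. h x epowr q \<partial>M)"
    by (intro nn_integral_cmult) measurable
  finally show ?thesis .
qed

section \<open>Dyadic cubes\<close>

text \<open>A dyadic cube of side 2^(-k) is a level set of the integer parts of 2^k y_i. In this
  form nestedness is arithmetic of floors.\<close>

lemma dyadic_cubeE:
  fixes S :: "(real ^ 'd) set"
  assumes "S \<in> dyadic_cubes"
  obtains k :: int and m :: "int ^ 'd" where "S = {y :: real ^ 'd. \<forall>i. \<lfloor>2 powi k * y $ i\<rfloor> = m $ i}"
proof -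
  obtain k :: int and m :: "int ^ 'd" where
    S: "S = (\<lambda>x. (2 powi (- k)) *\<^sub>R ((\<chi> i. of_int (m $ i)) + x)) ` {x. \<forall>i. x $ i \<in> {0..<1}}"
    using assms unfolding dyadic_cubes_def by blast
  have inv: "(2::real) powi k * 2 powi (- k) = 1"
    by (simp flip: power_int_add)
  have "S = {y :: real ^ 'd. \<forall>i. \<lfloor>2 powi k * y $ i\<rfloor> = m $ i}"
  proof (intro set_eqI iffI)
    fix y :: "real ^ 'd" assume "y \<in> S"
    then obtain x where x: "\<forall>i. x $ i \<in> {0..<1}" "y = (2 powi (- k)) *\<^sub>R ((\<chi> i. of_int (m $ i)) + x)"
      unfolding S by blast
    have "2 powi k * y $ i = of_int (m $ i) + x $ i" for i
      using inv by (simp add: x(2) flip: mult.assoc)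
    then show "y \<in> {y. \<forall>i. \<lfloor>2 powi k * y $ i\<rfloor> = m $ i}"
      using x(1) by (simp add: floor_eq_iff)
  next
    fix y :: "real ^ 'd" assume y: "y \<in> {y. \<forall>i. \<lfloor>2 powi k * y $ i\<rfloor> = m $ i}"
    define x where "x = (2 powi k) *\<^sub>R y - (\<chi> i. of_int (m $ i))"
    have "y = (2 powi (- k)) *\<^sub>R ((\<chi> i. of_int (m $ i)) + x)"
      using inv by (simp add: x_def mult.commute)
    moreover have "x $ i \<in> {0..<1}" for i
      using y by (auto simp: x_def floor_eq_iff) (smt (verit))+
    ultimately show "y \<in> S" unfolding S by blast
  qed
  then show ?thesis by (rule that)
qed

text \<open>The floor at the coarser scale \<open>k\<close> is the integer quotient of the floor at
  the finer scale \<open>l\<close> by 2^(l-k), hence determined by it.\<close>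

lemma floor_power_int_mono:
  fixes x y :: real
  assumes "k \<le> l" "\<lfloor>2 powi l * x\<rfloor> = \<lfloor>2 powi l * y\<rfloor>"
  shows "\<lfloor>2 powi k * x\<rfloor> = \<lfloor>2 powi k * y\<rfloor>"
proof -
  have "\<lfloor>2 powi k * z\<rfloor> = \<lfloor>2 powi l * z\<rfloor> div int (2 ^ nat (l - k))" for z :: real
  proof -
    have "(2::real) powi l = 2 powi k * 2 ^ nat (l - k)"
      using assms(1) power_int_add[of "2::real" k "l - k"] by (simp add: power_int_def[of _ "l - k"])
    then have "2 powi k * z = (2 powi l * z) / real_of_int (int (2 ^ nat (l - k)))"
      by simp
    then show ?thesis by (simp only: floor_divide_real_eq_div[OF of_nat_0_le_iff])
  qed
  then show ?thesis using assms(2) by simp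
qed

text \<open>Suppose the cubes share a point \<open>z\<close>. Every point of the finer cube has the
  same floors as \<open>z\<close> at the finer scale, hence also at the coarser one, and so lies in
  the coarser cube.\<close>

lemma dyadic_cubes_nested:
  fixes S T :: "(real ^ 'd) set"
  assumes "S \<in> dyadic_cubes" "T \<in> dyadic_cubes"
  shows "S \<inter> T = {} \<or> S \<subseteq> T \<or> T \<subseteq> S"
proof -
  obtain k and m :: "int ^ 'd" where S: "S = {y :: real ^ 'd. \<forall>i. \<lfloor>2 powi k * y $ i\<rfloor> = m $ i}"
    by (rule dyadic_cubeE[OF assms(1)])
  obtain l and n :: "int ^ 'd" where T: "T = {y :: real ^ 'd. \<forall>i. \<lfloor>2 powi l * y $ i\<rfloor> = n $ i}"
    by (rule dyadic_cubeE[OF assms(2)])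
  show ?thesis
  proof (cases "S \<inter> T = {}")
    case False
    then obtain z :: "real ^ 'd" where z: "\<And>i. \<lfloor>2 powi k * z $ i\<rfloor> = m $ i" "\<And>i. \<lfloor>2 powi l * z $ i\<rfloor> = n $ i"
      unfolding S T by blast
    show ?thesis
    proof (cases "k \<le> l")
      case True
      have "T \<subseteq> S"
      proof
        fix y assume "y \<in> T"
        then have "\<lfloor>2 powi l * y $ i\<rfloor> = \<lfloor>2 powi l * z $ i\<rfloor>" for i
          using z(2) by (simp add: T)
        from floor_power_int_mono[OF True this] show "y \<in> S"
          using z(1) by (simp add: S)
      qed
      then show ?thesis by simp
    next
      case False
      then have kl: "l \<le> k" by simp
      have "S \<subseteq> T"
      proof
        fix y assume "y \<in> S"
        then have "\<lfloor>2 powi k * y $ i\<rfloor> = \<lfloor>2 powi k * z $ i\<rfloor>" for i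
          using z(1) by (simp add: S)
        from floor_power_int_mono[OF kl this] show "y \<in> T"
          using z(2) by (simp add: T)
      qed
      then show ?thesis by simp
    qed
  qed simp
qed

text \<open>The half-open cube lies between the open and the closed box with the same corners, whose
  measures agree. This passes from dyadic cubes to the closed cubes in the supremum of
  \<open>Ap_const\<close>.\<close>

lemma dyadic_cube_subset_cube:
  fixes S :: "(real ^ 'd) set"
  assumes "S \<in> dyadic_cubes"
  obtains Q where "Q \<in> cubes" "S \<subseteq> Q" "emeasure lebesgue S = emeasure lebesgue Q"
    and "S \<in> sets lebesgue" "Q \<in> sets lebesgue" "compact Q"
    and "0 < emeasure lebesgue Q" "emeasure lebesgue Q < top"
proof -
  obtain k and m :: "int ^ 'd" where S: "S = {y :: real ^ 'd. \<forall>i. \<lfloor>2 powi k * y $ i\<rfloor> = m $ i}"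
    by (rule dyadic_cubeE[OF assms])
  define l where "l = (2::real) powi (- k)"
  define a :: "real ^ 'd" where "a = (\<chi> i. l * of_int (m $ i))"
  have l: "0 < l" "(2::real) powi k = 1 / l"
    by (auto simp: l_def power_int_minus divide_inverse)
  have S': "S = {y. \<forall>i. a $ i \<le> y $ i \<and> y $ i < a $ i + l}"
    unfolding S l(2) floor_eq_iff a_def using l(1) by (simp add: field_simps)
  let ?Q = "cbox a (a + vec l)" and ?B = "box a (a + vec l)"
  have sub: "S \<subseteq> ?Q" "?B \<subseteq> S"
    unfolding S' by (auto simp: mem_box_cart less_imp_le)
  have pos: "0 < (a + vec l - a) \<bullet> b" if "b \<in> Basis" for b
    using that l(1) by (auto simp: Basis_vec_def inner_axis)
  then have le: "a \<bullet> b \<le> (a + vec l) \<bullet> b" if "b \<in> Basis" for b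
    using pos[OF that] unfolding inner_diff_left by linarith
  have Q: "emeasure lborel ?Q = ennreal (\<Prod>b\<in>Basis. (a + vec l - a) \<bullet> b)"
    and B: "emeasure lborel ?B = ennreal (\<Prod>b\<in>Basis. (a + vec l - a) \<bullet> b)"
    using le by (auto intro: emeasure_lborel_cbox emeasure_lborel_box)
  have S_meas: "S \<in> sets borel"
    unfolding S' by measurable
  show ?thesis
  proof (rule that[of ?Q])
    show "?Q \<in> cubes" using l(1) unfolding cubes_def by blast
    show "S \<subseteq> ?Q" by (rule sub)
    have "emeasure lborel S \<le> emeasure lborel ?Q" "emeasure lborel ?B \<le> emeasure lborel S"
      using S_meas sub by (auto intro!: emeasure_mono)
    then show "emeasure lebesgue S = emeasure lebesgue ?Q"
      using S_meas Q B by simp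
    show "S \<in> sets lebesgue" using S_meas by simp
    show "0 < emeasure lebesgue ?Q" "emeasure lebesgue ?Q < top"
      using Q prod_pos[of Basis "\<lambda>b. (a + vec l - a) \<bullet> b", OF pos] by simp_all
  qed (simp_all)
qed

section \<open>Weights and the condition A-infinity\<close>

lemma locally_integrable_borel_measurable:
  fixes f :: "real ^ 'd \<Rightarrow> real"
  assumes "locally_integrable f"
  shows "f \<in> borel_measurable lebesgue"
proof (rule borel_measurable_LIMSEQ_real)
  \<comment> \<open>The restrictions to growing balls are integrable and, at each point, eventually
    equal to \<open>f\<close>.\<close>
  define g where "g n x = indicat_real (cball 0 (real n)) x *\<^sub>R f x" for n :: nat and x
  show "g n \<in> borel_measurable lebesgue" for n
  proof -
    have "f absolutely_integrable_on cball 0 (real n)"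
      using assms unfolding locally_integrable_def by simp
    then show ?thesis
      unfolding set_integrable_def g_def by (rule borel_measurable_integrable)
  qed
  show "(\<lambda>n. g n x) \<longlonglongrightarrow> f x" for x
  proof (rule tendsto_eventually)
    have "\<forall>\<^sub>F n in sequentially. norm x \<le> real n"
      by real_asymp
    then show "\<forall>\<^sub>F n in sequentially. g n x = f x"
      by eventually_elim (simp add: g_def)
  qed
qed

lemma wmeasure_mono: "A \<subseteq> B \<Longrightarrow> wmeasure w A \<le> wmeasure w B"
  unfolding wmeasure_def by (intro nn_integral_mono) (auto split: split_indicator)

lemma wmeasure_compact_finite:
  fixes w :: "real ^ 'd \<Rightarrow> real"
  assumes "weight w" "compact Q"
  shows "wmeasure w Q < top"
proof -
  have "integrable lebesgue (\<lambda>x. indicator Q x *\<^sub>R w x)"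
    using assms unfolding weight_def locally_integrable_def set_integrable_def by blast
  then have "(\<integral>\<^sup>+x. ennreal (norm (indicator Q x *\<^sub>R w x)) \<partial>lebesgue) < \<infinity>"
    by (simp add: integrable_iff_bounded)
  also have "(\<integral>\<^sup>+x. ennreal (norm (indicator Q x *\<^sub>R w x)) \<partial>lebesgue) = wmeasure w Q"
    unfolding wmeasure_def using assms(1)
    by (intro nn_integral_cong) (auto simp: weight_def split: split_indicator)
  finally show ?thesis by simp
qed

section \<open>The A_p estimate for large subsets of dyadic cubes\<close>

lemma ennreal_divide_mult_cancel:
  fixes x y :: ennreal
  assumes "y \<noteq> 0" "y < top"
  shows "x / y * y = x"
  using assms mult_divide_eq_ennreal[of y x]
  by (simp add: mult.commute[of "x / y"] ennreal_times_divide mult.commute[of y x])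

lemma ennreal_divide_mult_le: "x / y * y \<le> (x :: ennreal)" if "y < top"
  using that by (cases "y = 0") (auto simp: ennreal_divide_mult_cancel)

lemma epowr_of_nat: "0 < k \<Longrightarrow> x epowr real k = x ^ k"
proof (cases x)
  case (real t)
  then show "0 < k \<Longrightarrow> x epowr real k = x ^ k"
    by (cases "t = 0") (auto simp: epowr_ennreal powr_realpow ennreal_power)
qed (simp add: top_power_ennreal)

text \<open>Writes 1 as w^(1/p) times the power 1/p' of the dual weight, which is the product that
  Hoelder's inequality is applied to in the A_p estimate.\<close>

lemma weighted_power_mult_dual_weight:
  assumes "0 < w" "1 < p"
  shows "ennreal w epowr (1 / p) * (ennreal w epowr (- 1 / (p - 1))) epowr (1 - 1 / p) = 1"
proof -
  have 1: "ennreal w epowr (- 1 / (p - 1)) = ennreal (w powr (- 1 / (p - 1)))"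
    using assms by (simp add: epowr_def)
  have "- 1 / (p - 1) * (1 - 1 / p) = - (1 / p)"
    using assms by (simp add: divide_simps)
  then have 2: "(w powr (- 1 / (p - 1))) powr (1 - 1 / p) = w powr (- (1 / p))"
    by (simp only: powr_powr)
  have "w powr (1 / p) * (w powr (- 1 / (p - 1))) powr (1 - 1 / p) = 1"
    unfolding 2 powr_add[symmetric] using assms by simp
  moreover have "0 < 1 / p" "0 < 1 - 1 / p" using assms by simp_all
  ultimately show ?thesis
    unfolding 1 using assms(1)
    by (simp only: epowr_ennreal powr_ge_zero less_imp_le ennreal_mult[symmetric] ennreal_1)
qed

text \<open>Let V be the integral of the dual weight over the closed cube Q. Hoelder's inequality
  gives |E|^p \<le> w(E) V^(p-1), and the A_p condition gives w(Q) V^(p-1) \<le> [w]_{A_p} |Q|^p.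
  Combine the two through \<eta> |Q| \<le> |E|.\<close>

lemma Ap_const_sparse_le:
  fixes w :: "real ^ 'd \<Rightarrow> real"
  assumes p: "1 < p" and w: "weight w" and Ap: "Ap_const p w < top"
    and S: "S \<in> dyadic_cubes" and E: "E \<in> sets lebesgue" "E \<subseteq> S"
    and \<eta>: "0 < \<eta>" "ennreal \<eta> * emeasure lebesgue S \<le> emeasure lebesgue E"
  shows "ennreal (\<eta> powr p) * wmeasure w S \<le> Ap_const p w * wmeasure w E"
proof -
  obtain Q where Q: "Q \<in> cubes" "S \<subseteq> Q" "emeasure lebesgue S = emeasure lebesgue Q"
    and [measurable]: "S \<in> sets lebesgue" "Q \<in> sets lebesgue" and "compact Q"
    and Qpos: "0 < emeasure lebesgue Q" "emeasure lebesgue Q < top"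
    by (rule dyadic_cube_subset_cube[OF S])
  note [measurable] = E(1)
  define L where "L = emeasure lebesgue Q"
  have L: "L \<noteq> 0" "L < top" using Qpos by (auto simp: L_def)
  have [measurable]: "w \<in> borel_measurable lebesgue"
    using w by (auto simp: weight_def locally_integrable_borel_measurable)
  have w0: "0 \<le> w x" for x using w by (simp add: weight_def)
  define v where "v x = ennreal (w x) epowr (- 1 / (p - 1))" for x
  have v [measurable]: "v \<in> borel_measurable lebesgue"
    unfolding v_def by measurable
  define V where "V = (\<integral>\<^sup>+x\<in>Q. v x \<partial>lebesgue)"
  define W where "W = wmeasure w Q"
  have "average (\<lambda>x. ennreal (w x)) Q *
      average (\<lambda>x. ennreal (w x) epowr (- 1 / (p - 1))) Q epowr (p - 1) \<le> Ap_const p w"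
    unfolding Ap_const_def by (rule SUP_upper[OF Q(1)])
  then have A: "W / L * (V / L) epowr (p - 1) \<le> Ap_const p w"
    by (simp add: average_def W_def wmeasure_def V_def v_def L_def)
  have SW: "wmeasure w S \<le> W" unfolding W_def by (rule wmeasure_mono[OF Q(2)])
  \<comment> \<open>If w vanishes on a set of positive measure in Q, then V may be infinite; the convention
    0 * top = 0 then forces w to vanish almost everywhere on Q.\<close>
  show ?thesis
  proof (cases "V = top")
    case True
    moreover have "L \<noteq> top" using L(2) by auto
    ultimately have "V / L = top" by (simp add: ennreal_top_divide)
    then have "W / L * top \<le> Ap_const p w"
      using A p by simp
    then have "W / L = 0"
      using Ap by (cases "W / L = 0") (auto simp: ennreal_mult_top top_unique)
    then have "W = 0" using ennreal_divide_mult_cancel[OF L, of W] by (metis mult_zero_left)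
    then show ?thesis using SW by simp
  next
    case False
    \<comment> \<open>The exponent of the dual weight is negative, so \<open>v x\<close> is
      \<open>top\<close> where \<open>w x = 0\<close>. Finiteness of \<open>V\<close> thus makes
      \<open>w\<close> positive almost everywhere on \<open>Q\<close>, and the factorisation of 1
      holds there.\<close>
    have "AE x in lebesgue. v x * indicator Q x \<noteq> \<infinity>"
      by (rule nn_integral_PInf_AE) (use False in \<open>auto simp: V_def\<close>)
    then have "AE x in lebesgue. indicator E x
        \<le> (ennreal (w x) * indicator E x) epowr (1 / p) * (v x * indicator Q x) epowr (1 - 1 / p)"
    proof eventually_elim
      case (elim x)
      show ?case
      proof (cases "x \<in> E")
        case True
        then have x: "x \<in> Q" using E(2) Q(2) by blast
        have "w x \<noteq> 0"
          using elim x p by (auto simp: v_def epowr_def)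
        then have "0 < w x" using w0[of x] by simp
        then show ?thesis
          using weighted_power_mult_dual_weight[of "w x" p] p x True by (simp add: v_def)
      qed simp
    qed
    then have "emeasure lebesgue E \<le> (\<integral>\<^sup>+x. (ennreal (w x) * indicator E x) epowr (1 / p) *
        (v x * indicator Q x) epowr (1 - 1 / p) \<partial>lebesgue)"
      by (subst nn_integral_indicator[symmetric, OF E(1)]) (rule nn_integral_mono_AE)
    also have "\<dots> \<le> wmeasure w E epowr (1 / p) * V epowr (1 - 1 / p)"
      unfolding wmeasure_def V_def by (rule nn_integral_mult_epowr_le) (use p in auto)
    finally have "emeasure lebesgue E epowr p \<le> (wmeasure w E epowr (1 / p) * V epowr (1 - 1 / p)) epowr p"
      using p by (intro epowr_mono) auto
    also have "\<dots> = wmeasure w E * V epowr (p - 1)"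
      using p by (simp add: epowr_mult epowr_epowr left_diff_distrib)
    finally have H: "emeasure lebesgue E epowr p \<le> wmeasure w E * V epowr (p - 1)" .
    have Lp: "L epowr p \<noteq> 0" "L epowr p < top"
      using p L by (simp_all add: epowr_eq_0_iff epowr_less_top_iff)
    have "W * V epowr (p - 1) = (W / L * L) * (V / L * L) epowr (p - 1)"
      by (simp only: ennreal_divide_mult_cancel[OF L])
    also have "\<dots> = (W / L * (V / L) epowr (p - 1)) * L epowr (1 + (p - 1))"
      using p by (subst epowr_add) (auto simp: epowr_mult mult_ac)
    also have "\<dots> \<le> Ap_const p w * L epowr p"
      using A by (simp add: mult_right_mono)
    finally have WV: "W * V epowr (p - 1) \<le> Ap_const p w * L epowr p" .
    \<comment> \<open>Both sides are compared after multiplication by \<open>L epowr p\<close>,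
      which is finite and nonzero and cancels at the end; this avoids dividing by powers of
      \<open>V\<close>.\<close>
    have "(ennreal (\<eta> powr p) * wmeasure w S) * L epowr p
        = wmeasure w S * (ennreal \<eta> * emeasure lebesgue S) epowr p"
      using p \<eta>(1) by (simp add: epowr_mult epowr_ennreal Q(3) L_def mult_ac)
    also have "\<dots> \<le> W * (wmeasure w E * V epowr (p - 1))"
      using p \<eta>(2) by (intro mult_mono SW order_trans[OF epowr_mono H]) auto
    also have "\<dots> \<le> (Ap_const p w * wmeasure w E) * L epowr p"
      using mult_left_mono[OF WV, of "wmeasure w E"] by (simp add: mult_ac)
    finally show ?thesis
      using Lp by (simp add: ennreal_mult_le_mult_iff mult.commute[of _ "L epowr p"])
  qed
qed

text \<open>A finite limit of the A_p constants makes one of them finite for some p > 1, and the A_p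
  estimate for this p applies. \<open>D\<close> depends on the weight and on \<open>\<eta>\<close>,
  but not on the cube or its subset.\<close>

lemma A_infty_sparse_le:
  fixes w :: "real ^ 'd \<Rightarrow> real"
  assumes "A_infty w" and \<eta>: "0 < \<eta>"
  obtains D where "D < top"
    and "\<And>S E. S \<in> dyadic_cubes \<Longrightarrow> E \<in> sets lebesgue \<Longrightarrow> E \<subseteq> S \<Longrightarrow>
      ennreal \<eta> * emeasure lebesgue S \<le> emeasure lebesgue E \<Longrightarrow> wmeasure w S \<le> D * wmeasure w E"
proof -
  obtain L where L: "L < top" "((\<lambda>p. Ap_const p w) \<longlongrightarrow> L) at_top" and w: "weight w"
    using assms(1) unfolding A_infty_def by blast
  have "\<forall>\<^sub>F p in at_top. Ap_const p w < top \<and> 1 < p"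
    using order_tendstoD(2)[OF L(2,1)] eventually_gt_at_top[of 1] by eventually_elim simp
  then obtain p where p: "Ap_const p w < top" "1 < p"
    using eventually_happens'[OF trivial_limit_at_top_linorder] by blast
  define e where "e = ennreal (\<eta> powr p)"
  have e: "e \<noteq> 0" "e < top" using \<eta> by (auto simp: e_def)
  show ?thesis
  proof (rule that[of "Ap_const p w / e"])
    show "Ap_const p w / e < top"
      using p(1) e by (auto simp: ennreal_divide_eq_top_iff simp flip: less_top)
    fix S E :: "(real ^ 'd) set"
    assume "S \<in> dyadic_cubes" "E \<in> sets lebesgue" "E \<subseteq> S"
      "ennreal \<eta> * emeasure lebesgue S \<le> emeasure lebesgue E"
    then have "e * wmeasure w S \<le> Ap_const p w * wmeasure w E"
      unfolding e_def using p w \<eta> by (intro Ap_const_sparse_le) auto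
    also have "\<dots> = e * (Ap_const p w / e * wmeasure w E)"
      using ennreal_divide_mult_cancel[OF e, of "Ap_const p w"]
      by (metis mult.assoc mult.commute)
    finally show "wmeasure w S \<le> Ap_const p w / e * wmeasure w E"
      using e by (simp add: ennreal_mult_le_mult_iff)
  qed
qed


section \<open>The multilinear embedding\<close>

lemma inverse_conj_exp: "1 < p \<Longrightarrow> 1 / conj_exp p = 1 - 1 / p"
  by (simp add: conj_exp_def diff_divide_distrib)

lemma sum_inverse_conj_exp:
  assumes "\<And>i. i \<in> {1..n} \<Longrightarrow> 1 < p i" "1 / r + (\<Sum>i=1..n. 1 / p i) = 1" "1 \<le> n"
  shows "(\<Sum>i=1..n. 1 / conj_exp (p i)) = real (n - 1) + 1 / r"
proof -
  have "(\<Sum>i=1..n. 1 / conj_exp (p i)) = (\<Sum>i=1..n. 1 - 1 / p i)"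
    using assms(1) by (intro sum.cong) (auto simp: inverse_conj_exp)
  also have "\<dots> = real n - (\<Sum>i=1..n. 1 / p i)"
    by (simp add: sum_subtractf)
  finally show ?thesis using assms(2,3) by (simp add: of_nat_diff)
qed

lemma sparse_familyD:
  assumes "sparse_family \<eta> \<S> E" "S \<in> \<S>"
  shows "S \<in> dyadic_cubes" "E S \<in> sets lebesgue" "E S \<subseteq> S"
    "ennreal \<eta> * emeasure lebesgue S \<le> emeasure lebesgue (E S)"
  using assms unfolding sparse_family_def by auto

lemma sparse_family_disjoint:
  "sparse_family \<eta> \<S> E \<Longrightarrow> F \<subseteq> \<S> \<Longrightarrow> disjoint_family_on E F"
  unfolding sparse_family_def by (blast intro: disjoint_family_on_mono)

lemma dyadic_cube_lebesgue:
  fixes S :: "(real ^ 'd) set"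
  assumes "S \<in> dyadic_cubes"
  shows "S \<in> sets lebesgue" "emeasure lebesgue S \<noteq> 0" "emeasure lebesgue S < top"
  using dyadic_cube_subset_cube[OF assms] by (metis less_irrefl)+

lemma wmeasure_dyadic_finite:
  fixes S :: "(real ^ 'd) set"
  assumes "weight w" "S \<in> dyadic_cubes"
  shows "wmeasure w S < top"
  using dyadic_cube_subset_cube[OF assms(2)] wmeasure_mono wmeasure_compact_finite[OF assms(1)]
  by (metis order.strict_trans1)

section \<open>The Carleson embedding for weighted and for Lebesgue measure\<close>

lemma emeasure_density_weight:
  "w \<in> borel_measurable lebesgue \<Longrightarrow> A \<in> sets lebesgue \<Longrightarrow>
    emeasure (density lebesgue (\<lambda>x. ennreal (w x))) A = wmeasure w A"
  unfolding wmeasure_def by (rule emeasure_density) auto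

text \<open>The left side is the sum of the p-th powers of the \<open>Y\<close> of case (a), that is
  of \<sigma>(S) times the p-th power of the \<sigma>-average. Replacing \<sigma>(S) by D
  \<sigma>(E(S)) brings in the disjoint sets, and the embedding applies to the measure \<sigma>
  dx.\<close>

lemma weighted_carleson_embedding:
  fixes \<sigma> f :: "real ^ 'd \<Rightarrow> real"
  assumes p: "1 < p" and \<sigma>: "weight \<sigma>"
    and f: "\<And>x. 0 \<le> f x" "locally_integrable f"
    and F: "finite F" "F \<subseteq> \<S>" "sparse_family \<eta> \<S> E"
    and D: "\<And>S. S \<in> F \<Longrightarrow> wmeasure \<sigma> S \<le> D * wmeasure \<sigma> (E S)"
  shows "(\<Sum>S\<in>F. ((\<integral>\<^sup>+x\<in>S. ennreal (f x * \<sigma> x) \<partial>lebesgue) / wmeasure \<sigma> S *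
      wmeasure \<sigma> S epowr (1 / p)) epowr p)
    \<le> D * ennreal (carleson_const p) * (\<integral>\<^sup>+x. ennreal (\<bar>f x\<bar> powr p * \<sigma> x) \<partial>lebesgue)"
proof -
  have [measurable]: "\<sigma> \<in> borel_measurable lebesgue" "f \<in> borel_measurable lebesgue"
    using \<sigma> f by (auto simp: weight_def locally_integrable_borel_measurable)
  have \<sigma>0: "0 \<le> \<sigma> x" for x using \<sigma> by (simp add: weight_def)
  define M where "M = density lebesgue (\<lambda>x. ennreal (\<sigma> x))"
  have sets_M [simp]: "sets M = sets lebesgue" by (simp add: M_def)
  have M: "emeasure M A = wmeasure \<sigma> A" if "A \<in> sets lebesgue" for A
    unfolding M_def using that by (intro emeasure_density_weight) auto
  define a where "a S = (\<integral>\<^sup>+x\<in>S. ennreal (f x * \<sigma> x) \<partial>lebesgue) / wmeasure \<sigma> S" for S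
  note S = sparse_familyD[OF F(3) subsetD[OF F(2)]]
  note S' = dyadic_cube_lebesgue[OF S(1)]
  have fin: "wmeasure \<sigma> S < top" if "S \<in> F" for S
    by (rule wmeasure_dyadic_finite[OF \<sigma> S(1)[OF that]])
  have fM [measurable]: "(\<lambda>x. ennreal (f x)) \<in> borel_measurable M"
    unfolding M_def by measurable
  have "(\<Sum>S\<in>F. (a S * wmeasure \<sigma> S epowr (1 / p)) epowr p) = (\<Sum>S\<in>F. wmeasure \<sigma> S * a S epowr p)"
    using p by (simp add: epowr_mult epowr_epowr mult.commute)
  also have "\<dots> \<le> (\<Sum>S\<in>F. D * wmeasure \<sigma> (E S) * a S epowr p)"
    by (intro sum_mono mult_right_mono D) auto
  also have "\<dots> = D * (\<Sum>S\<in>F. emeasure M (E S) * a S epowr p)"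
    using S(2) by (simp add: M sum_distrib_left mult.assoc)
  also have "\<dots> \<le> D * (ennreal (carleson_const p) * (\<integral>\<^sup>+x. ennreal (f x) epowr p \<partial>M))"
  proof (intro mult_left_mono carleson_embedding p F(1) fM)
    show "F \<subseteq> sets M" using S' by auto
    show "S \<inter> T = {} \<or> S \<subseteq> T \<or> T \<subseteq> S" if "S \<in> F" "T \<in> F" for S T
      by (intro dyadic_cubes_nested S that)
    fix A assume A: "A \<in> F"
    show "emeasure M A < top" using fin A S' by (simp add: M)
    show "E A \<in> sets M" "E A \<subseteq> A" using S A by auto
    have "a A * emeasure M A \<le> (\<integral>\<^sup>+x\<in>A. ennreal (f x * \<sigma> x) \<partial>lebesgue)"
      using S'(1)[OF A] by (simp add: M a_def ennreal_divide_mult_le[OF fin[OF A]])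
    also have "\<dots> = (\<integral>\<^sup>+x. ennreal (\<sigma> x) * (ennreal (f x) * indicator A x) \<partial>lebesgue)"
      using f(1) \<sigma>0 by (simp add: ennreal_mult mult_ac)
    also have "\<dots> = (\<integral>\<^sup>+x\<in>A. ennreal (f x) \<partial>M)"
      unfolding M_def using S'(1)[OF A] by (intro nn_integral_density[symmetric]) auto
    finally show "a A * emeasure M A \<le> (\<integral>\<^sup>+x\<in>A. ennreal (f x) \<partial>M)" .
  qed (use sparse_family_disjoint[OF F(3,2)] in auto)
  also have "(\<integral>\<^sup>+x. ennreal (f x) epowr p \<partial>M) = (\<integral>\<^sup>+x. ennreal (\<sigma> x) * ennreal (f x) epowr p \<partial>lebesgue)"
    unfolding M_def by (rule nn_integral_density) auto
  also have "\<dots> = (\<integral>\<^sup>+x. ennreal (\<bar>f x\<bar> powr p * \<sigma> x) \<partial>lebesgue)"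
    using f(1) \<sigma>0 p by (simp add: epowr_ennreal ennreal_mult mult.commute)
  finally show ?thesis unfolding a_def by (simp add: mult.assoc)
qed

text \<open>The left side is the sum of the p-th powers of the \<open>Y\<close> of case (b). Since
  (q/p) p = q, it is the Carleson sum with exponent \<open>q\<close>; the exponent \<open>p\<close>
  only fixes how the power is distributed.\<close>

lemma lebesgue_carleson_embedding:
  fixes h :: "real ^ 'd \<Rightarrow> ennreal"
  assumes p: "0 < p" and q: "1 < q"
    and h [measurable]: "h \<in> borel_measurable lebesgue"
    and F: "finite F" "F \<subseteq> \<S>" "sparse_family \<eta> \<S> E"
  shows "(\<Sum>S\<in>F. (((\<integral>\<^sup>+x\<in>S. h x \<partial>lebesgue) / emeasure lebesgue S) epowr (q / p) *
      emeasure lebesgue (E S) epowr (1 / p)) epowr p)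
    \<le> ennreal (carleson_const q) * (\<integral>\<^sup>+x. h x epowr q \<partial>lebesgue)"
proof -
  define a where "a S = (\<integral>\<^sup>+x\<in>S. h x \<partial>lebesgue) / emeasure lebesgue S" for S
  note S = sparse_familyD[OF F(3) subsetD[OF F(2)]]
  note S' = dyadic_cube_lebesgue[OF S(1)]
  have "(\<Sum>S\<in>F. (a S epowr (q / p) * emeasure lebesgue (E S) epowr (1 / p)) epowr p)
      = (\<Sum>S\<in>F. emeasure lebesgue (E S) * a S epowr q)"
    using p q by (simp add: epowr_mult epowr_epowr mult.commute)
  also have "\<dots> \<le> ennreal (carleson_const q) * (\<integral>\<^sup>+x. h x epowr q \<partial>lebesgue)"
  proof (intro carleson_embedding q F(1) h)
    show "F \<subseteq> sets lebesgue" using S' by auto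
    show "S \<inter> T = {} \<or> S \<subseteq> T \<or> T \<subseteq> S" if "S \<in> F" "T \<in> F" for S T
      by (intro dyadic_cubes_nested S that)
    show "a A * emeasure lebesgue A \<le> (\<integral>\<^sup>+x\<in>A. h x \<partial>lebesgue)" if "A \<in> F" for A
      unfolding a_def by (rule ennreal_divide_mult_le[OF S'(3)[OF that]])
  qed (use S S' sparse_family_disjoint[OF F(3,2)] in auto)
  finally show ?thesis unfolding a_def .
qed

section \<open>Products of averages, and Hoelder's inequality over the family\<close>

lemma prod_average_eq:
  fixes x :: "nat \<Rightarrow> ennreal"
  assumes L: "L \<noteq> 0" "L < top" and b: "\<And>i. i \<in> {1..n} \<Longrightarrow> 0 < b i" and n: "1 \<le> n"
  shows "(\<Prod>i=1..n. x i epowr b i) = L epowr (\<Sum>i=1..n. b i) * (\<Prod>i=1..n. (x i / L) epowr b i)"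
proof -
  have "(\<Prod>i=1..n. x i epowr b i) = (\<Prod>i=1..n. L epowr b i * (x i / L) epowr b i)"
    using ennreal_divide_mult_cancel[OF L] b
    by (intro prod.cong refl) (metis epowr_mult mult.commute)
  also have "L epowr (\<Sum>i=1..n. b i) = (\<Prod>i=1..n. L epowr b i)"
    using n b by (intro epowr_sum) auto
  ultimately show ?thesis by (simp add: prod.distrib)
qed

text \<open>The part common to both cases. Everything is done on finite subfamilies, for which the
  Carleson embedding is available; the infinite sum of nonnegative terms is the supremum of these
  partial sums.\<close>

lemma infsum_prod_le:
  fixes T X :: "'a \<Rightarrow> ennreal" and Y :: "nat \<Rightarrow> 'a \<Rightarrow> ennreal"
  assumes p: "\<And>i. i \<in> {1..n} \<Longrightarrow> 0 < p i" and r: "0 < r" "1 / r + (\<Sum>i=1..n. 1 / p i) = 1"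
    and T: "\<And>S. S \<in> \<S> \<Longrightarrow> T S \<le> B * (X S * (\<Prod>i=1..n. Y i S))"
    and Y: "\<And>F i. finite F \<Longrightarrow> F \<subseteq> \<S> \<Longrightarrow> i \<in> {1..n} \<Longrightarrow> (\<Sum>S\<in>F. Y i S epowr p i) \<le> c i * N i"
  shows "(\<Sum>\<^sub>\<infinity>S\<in>\<S>. T S) \<le> (B * (\<Prod>i=1..n. c i epowr (1 / p i))) *
    (\<Sum>\<^sub>\<infinity>S\<in>\<S>. X S epowr r) epowr (1 / r) * (\<Prod>i=1..n. N i epowr (1 / p i))"
proof -
  \<comment> \<open>\<open>X\<close> gets the index 0, so that it joins the \<open>Y i\<close> in
    one family whose exponents add up to 1.\<close>
  define a where "a i = (if i = 0 then 1 / r else 1 / p i)" for i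
  define u where "u i S = (if i = 0 then X S epowr r else Y i S epowr p i)" for i S
  have split: "(\<Prod>i=0..n. f i) = f 0 * (\<Prod>i=1..n. f i)" for f :: "nat \<Rightarrow> ennreal"
    by (simp add: prod.atLeast_Suc_atMost)
  have a: "0 < a i" if "i \<in> {0..n}" for i using p[of i] r(1) that by (auto simp: a_def)
  have "(\<Sum>i=0..n. a i) = a 0 + (\<Sum>i=1..n. a i)"
    by (simp add: sum.atLeast_Suc_atMost)
  also have "(\<Sum>i=1..n. a i) = (\<Sum>i=1..n. 1 / p i)"
    by (intro sum.cong) (auto simp: a_def)
  finally have a1: "(\<Sum>i=0..n. a i) = 1" using r(2) by (simp add: a_def)
  have "(\<Sum>S\<in>F. T S) \<le> (B * (\<Prod>i=1..n. c i epowr (1 / p i))) *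
    (\<Sum>\<^sub>\<infinity>S\<in>\<S>. X S epowr r) epowr (1 / r) * (\<Prod>i=1..n. N i epowr (1 / p i))"
    if F: "finite F" "F \<subseteq> \<S>" for F
  proof -
    have u: "u i S epowr a i = (if i = 0 then X S else Y i S)" if "i \<in> {0..n}" for i S
      using p[of i] r(1) that by (auto simp: u_def a_def epowr_epowr)
    have pu: "(\<Prod>i=1..n. u i S epowr a i) = (\<Prod>i=1..n. Y i S)" for S
      by (intro prod.cong) (auto simp: u)
    have pu': "(\<Prod>i=1..n. (\<Sum>S\<in>F. u i S) epowr a i)
        = (\<Prod>i=1..n. (\<Sum>S\<in>F. Y i S epowr p i) epowr (1 / p i))"
      by (intro prod.cong) (auto simp: u_def a_def)
    have "(\<Sum>S\<in>F. T S) \<le> (\<Sum>S\<in>F. B * (X S * (\<Prod>i=1..n. Y i S)))"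
      using F(2) by (intro sum_mono T) auto
    also have "\<dots> = B * (\<Sum>S\<in>F. \<Prod>i=0..n. u i S epowr a i)"
      unfolding split pu sum_distrib_left by (simp add: u)
    also have "\<dots> \<le> B * (\<Prod>i=0..n. (\<Sum>S\<in>F. u i S) epowr a i)"
      by (intro mult_left_mono sum_prod_epowr_le F(1) a a1) auto
    also have "\<dots> = B * ((\<Sum>S\<in>F. X S epowr r) epowr (1 / r) *
        (\<Prod>i=1..n. (\<Sum>S\<in>F. Y i S epowr p i) epowr (1 / p i)))"
      unfolding split pu' by (simp add: u_def a_def)
    also have "\<dots> \<le> B * ((\<Sum>\<^sub>\<infinity>S\<in>\<S>. X S epowr r) epowr (1 / r) * (\<Prod>i=1..n. (c i * N i) epowr (1 / p i)))"
    proof (intro mult_left_mono mult_mono epowr_mono prod_mono_ennreal)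
      show "(\<Sum>S\<in>F. X S epowr r) \<le> (\<Sum>\<^sub>\<infinity>S\<in>\<S>. X S epowr r)"
        by (subst nonneg_infsum_complete) (use F in \<open>auto intro!: SUP_upper\<close>)
    qed (use p r(1) Y[OF F] in auto)
    also have "(\<Prod>i=1..n. (c i * N i) epowr (1 / p i))
        = (\<Prod>i=1..n. c i epowr (1 / p i)) * (\<Prod>i=1..n. N i epowr (1 / p i))"
      unfolding prod.distrib[symmetric] using p by (intro prod.cong) (auto simp: epowr_mult)
    finally show ?thesis by (simp add: mult_ac)
  qed
  then show ?thesis
    by (subst nonneg_infsum_complete) (auto intro!: SUP_least)
qed

section \<open>Case (a): weights satisfying the A_infinity condition\<close>

lemma embedding_A_infty:
  fixes \<sigma> :: "nat \<Rightarrow> real ^ 'd \<Rightarrow> real"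
  assumes n: "2 \<le> n" and \<sigma>: "\<And>i. i \<in> {1..n} \<Longrightarrow> weight (\<sigma> i)"
    and \<eta>: "0 < \<eta>" and p: "\<And>i. i \<in> {1..n} \<Longrightarrow> 1 < p i"
    and r: "0 < r" "1 / r + (\<Sum>i=1..n. 1 / p i) = 1"
    and sp: "sparse_family \<eta> \<S> E"
    and D: "\<And>i S. i \<in> {1..n} \<Longrightarrow> S \<in> \<S> \<Longrightarrow> wmeasure (\<sigma> i) S \<le> D i * wmeasure (\<sigma> i) (E S)"
    and f: "\<And>i x. i \<in> {1..n} \<Longrightarrow> 0 \<le> f i x" "\<And>i. i \<in> {1..n} \<Longrightarrow> locally_integrable (f i)"
  shows "multilinear_embedding n p \<sigma> K \<S> f ((ennreal (1 / \<eta>) epowr (1 / r) *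
    (\<Prod>i=1..n. (D i * ennreal (carleson_const (p i))) epowr (1 / p i))) * A0_weights n r p \<sigma> K \<S> E)"
proof -
  define J where "J i S = (\<integral>\<^sup>+x\<in>S. ennreal (f i x * \<sigma> i x) \<partial>lebesgue)" for i S
  define Y where "Y i S = J i S / wmeasure (\<sigma> i) S * wmeasure (\<sigma> i) S epowr (1 / p i)" for i S
  define G where "G S = ennreal (K S) * emeasure lebesgue S ^ (n - 1) *
    (\<Prod>i=1..n. (wmeasure (\<sigma> i) S / emeasure lebesgue S) epowr (1 / conj_exp (p i)))" for S
  define X where "X S = G S * emeasure lebesgue (E S) epowr (1 / r)" for S
  have conj_pos: "0 < 1 / conj_exp (p i)" if "i \<in> {1..n}" for i
    using p[OF that] by (simp add: inverse_conj_exp)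
  have J: "J i S = wmeasure (\<sigma> i) S epowr (1 / conj_exp (p i)) * Y i S"
    if i: "i \<in> {1..n}" and S: "S \<in> \<S>" for i S
  \<comment> \<open>On a cube without \<sigma>_i-mass the quotient in \<open>Y i S\<close> cannot be
    cancelled, but the integrand of \<open>J i S\<close> vanishes almost everywhere.\<close>
  proof (cases "wmeasure (\<sigma> i) S = 0")
    case True
    have [measurable]: "\<sigma> i \<in> borel_measurable lebesgue" "f i \<in> borel_measurable lebesgue"
        "S \<in> sets lebesgue"
      using \<sigma>[OF i] f(2)[OF i] dyadic_cube_lebesgue(1)[OF sparse_familyD(1)[OF sp S]]
      by (auto simp: weight_def locally_integrable_borel_measurable)
    have "AE x in lebesgue. ennreal (\<sigma> i x) * indicator S x = 0"
      using True unfolding wmeasure_def by (subst (asm) nn_integral_0_iff_AE) auto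
    then have "AE x in lebesgue. ennreal (f i x * \<sigma> i x) * indicator S x = 0"
      by eventually_elim (use f(1)[OF i] in \<open>auto simp: ennreal_mult' split: split_indicator\<close>)
    then have "J i S = 0"
      unfolding J_def by (subst nn_integral_0_iff_AE) auto
    then show ?thesis using True p[OF i] conj_pos[OF i] by simp
  next
    case False
    have "wmeasure (\<sigma> i) S epowr (1 / conj_exp (p i)) * wmeasure (\<sigma> i) S epowr (1 / p i) = wmeasure (\<sigma> i) S"
      using p[OF i] conj_pos[OF i] by (subst epowr_add[symmetric]) (auto simp: inverse_conj_exp)
    moreover have "J i S / wmeasure (\<sigma> i) S * wmeasure (\<sigma> i) S = J i S"
      using False wmeasure_dyadic_finite[OF \<sigma>[OF i] sparse_familyD(1)[OF sp S]]
      by (rule ennreal_divide_mult_cancel)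
    ultimately show ?thesis
      unfolding Y_def by (metis mult.left_commute mult.commute)
  qed
  have T: "ennreal (K S) * (\<Prod>i=1..n. J i S) \<le> ennreal (1 / \<eta>) epowr (1 / r) * (X S * (\<Prod>i=1..n. Y i S))"
    if S: "S \<in> \<S>" for S
  proof -
    let ?L = "emeasure lebesgue S"
    note cube = dyadic_cube_lebesgue[OF sparse_familyD(1)[OF sp S]]
    \<comment> \<open>Sparseness trades |S| for |E(S)| / \<eta>. Only the power 1/r is traded here,
      since the \<open>Y i\<close> contain no power of |E(S)|.\<close>
    have "?L = ennreal (1 / \<eta>) * (ennreal \<eta> * ?L)"
      using \<eta> by (simp flip: mult.assoc ennreal_mult)
    also have "\<dots> \<le> ennreal (1 / \<eta>) * emeasure lebesgue (E S)"
      by (intro mult_left_mono sparse_familyD(4)[OF sp S]) simp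
    finally have le: "?L epowr (1 / r) \<le> ennreal (1 / \<eta>) epowr (1 / r) * emeasure lebesgue (E S) epowr (1 / r)"
      using r(1) by (subst epowr_mult[symmetric]) (auto intro: epowr_mono)
    have "(\<Prod>i=1..n. J i S) = (\<Prod>i=1..n. wmeasure (\<sigma> i) S epowr (1 / conj_exp (p i))) * (\<Prod>i=1..n. Y i S)"
      unfolding prod.distrib[symmetric] using J S by (intro prod.cong) auto
    also have "(\<Prod>i=1..n. wmeasure (\<sigma> i) S epowr (1 / conj_exp (p i)))
        = ?L epowr (\<Sum>i=1..n. 1 / conj_exp (p i)) *
          (\<Prod>i=1..n. (wmeasure (\<sigma> i) S / ?L) epowr (1 / conj_exp (p i)))"
      using n by (intro prod_average_eq cube conj_pos) auto
    \<comment> \<open>The exponents 1/p_i' add up to n - 1 + 1/r: the first part is the power of |S|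
      in \<open>G S\<close>, the second becomes the factor |E(S)|^(1/r) of
      \<open>X S\<close>.\<close>
    also have "?L epowr (\<Sum>i=1..n. 1 / conj_exp (p i)) = ?L ^ (n - 1) * ?L epowr (1 / r)"
    proof -
      have "0 < n - 1" "0 < real (n - 1)" "0 < 1 / r" "1 \<le> n"
        using n r(1) by simp_all
      then show ?thesis
        by (simp only: sum_inverse_conj_exp[OF p r(2)] epowr_add epowr_of_nat)
    qed
    finally have "ennreal (K S) * (\<Prod>i=1..n. J i S) = ?L epowr (1 / r) * (G S * (\<Prod>i=1..n. Y i S))"
      by (simp add: G_def mult_ac)
    also have "\<dots> \<le> (ennreal (1 / \<eta>) epowr (1 / r) * emeasure lebesgue (E S) epowr (1 / r)) *
        (G S * (\<Prod>i=1..n. Y i S))"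
      by (intro mult_right_mono le) simp
    finally show ?thesis by (simp add: X_def mult_ac)
  qed
  have Xr: "X S epowr r = G S epowr r * emeasure lebesgue (E S)" for S
    using r(1) by (simp add: X_def epowr_mult epowr_epowr)
  have "(\<Sum>\<^sub>\<infinity>S\<in>\<S>. ennreal (K S) * (\<Prod>i=1..n. J i S)) \<le> (ennreal (1 / \<eta>) epowr (1 / r) *
      (\<Prod>i=1..n. (D i * ennreal (carleson_const (p i))) epowr (1 / p i))) *
    (\<Sum>\<^sub>\<infinity>S\<in>\<S>. X S epowr r) epowr (1 / r) *
    (\<Prod>i=1..n. (\<integral>\<^sup>+x. ennreal (\<bar>f i x\<bar> powr p i * \<sigma> i x) \<partial>lebesgue) epowr (1 / p i))"
  proof (rule infsum_prod_le[OF _ r T])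
    show "0 < p i" if "i \<in> {1..n}" for i using p[OF that] by simp
    show "(\<Sum>S\<in>F. Y i S epowr p i) \<le> D i * ennreal (carleson_const (p i)) *
        (\<integral>\<^sup>+x. ennreal (\<bar>f i x\<bar> powr p i * \<sigma> i x) \<partial>lebesgue)"
      if "finite F" "F \<subseteq> \<S>" "i \<in> {1..n}" for F i
      unfolding Y_def J_def using that
      by (intro weighted_carleson_embedding[OF p \<sigma> f _ _ sp] D) auto
  qed
  then show ?thesis
    unfolding multilinear_embedding_def A0_weights_def wnorm_def Xr J_def G_def .
qed

section \<open>Case (b): averages of bumped weights\<close>

lemma nn_integral_weight_bump_le:
  fixes f \<sigma> :: "'a \<Rightarrow> real"
  assumes p: "1 < p" and \<theta>: "1 < \<theta>" and nonneg: "\<And>x. 0 \<le> f x" "\<And>x. 0 \<le> \<sigma> x"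
    and [measurable]: "f \<in> borel_measurable M" "\<sigma> \<in> borel_measurable M" "S \<in> sets M"
    and q: "q = p - (p - 1) / \<theta>"
  shows "(\<integral>\<^sup>+x\<in>S. ennreal (f x * \<sigma> x) \<partial>M)
    \<le> (\<integral>\<^sup>+x\<in>S. ennreal (f x powr p * \<sigma> x) epowr (1 / q) \<partial>M) epowr (q / p) *
      (\<integral>\<^sup>+x\<in>S. ennreal (\<sigma> x powr \<theta>) \<partial>M) epowr (1 / (\<theta> * conj_exp p))"
proof -
  have b: "1 / (\<theta> * conj_exp p) = (p - 1) / (\<theta> * p)"
    by (simp add: conj_exp_def)
  have "(p - 1) / \<theta> < p - 1"
    using p \<theta> by (simp add: divide_simps)
  then have q1: "1 < q" by (simp add: q)
  have sum1: "q / p + (p - 1) / (\<theta> * p) = 1"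
    using p \<theta> by (simp add: q field_simps)
  \<comment> \<open>This is f \<sigma> = (f^p \<sigma>)^(1/p) \<sigma>^(1/p'). The second factor is
    a power of \<sigma>^\<theta> with exponent 1/(\<theta> p'), which leaves the Hoelder exponent
    q/p = 1 - 1/(\<theta> p') to the first; hence the choice of \<open>q\<close>.\<close>
  have split: "ennreal (f x * \<sigma> x) * indicator S x =
    (ennreal (f x powr p * \<sigma> x) epowr (1 / q) * indicator S x) epowr (q / p) *
    (ennreal (\<sigma> x powr \<theta>) * indicator S x) epowr ((p - 1) / (\<theta> * p))" for x
  proof (cases "x \<in> S")
    case True
    have "f x * \<sigma> x = (f x powr p * \<sigma> x) powr (1 / p) * (\<sigma> x powr \<theta>) powr ((p - 1) / (\<theta> * p))"
      using nonneg[of x] p \<theta>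
      by (cases "\<sigma> x = 0") (auto simp: powr_mult powr_powr diff_divide_distrib powr_diff)
    moreover have "((f x powr p * \<sigma> x) powr (1 / q)) powr (q / p) = (f x powr p * \<sigma> x) powr (1 / p)"
      using q1 by (simp add: powr_powr)
    ultimately show ?thesis
      using True nonneg p \<theta> q1 by (simp add: epowr_ennreal flip: ennreal_mult)
  next
    case False
    then show ?thesis using p \<theta> q1 by simp
  qed
  show ?thesis
    unfolding split b by (rule nn_integral_mult_epowr_le) (use p \<theta> q1 sum1 in auto)
qed

text \<open>The Hoelder exponents of each factor add up to 1, so each integral \<open>J i S\<close>
  releases exactly one power of |S|. Of these n powers, n - 1 belong to A_0 and the last one is paid
  for by sparseness.\<close>

lemma embedding_bump:
  fixes \<sigma> :: "nat \<Rightarrow> real ^ 'd \<Rightarrow> real"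
  assumes n: "2 \<le> n" and \<sigma>: "\<And>i. i \<in> {1..n} \<Longrightarrow> weight (\<sigma> i)"
    and \<eta>: "0 < \<eta>" and p: "\<And>i. i \<in> {1..n} \<Longrightarrow> 1 < p i"
    and r: "0 < r" "1 / r + (\<Sum>i=1..n. 1 / p i) = 1" and \<theta>: "1 < \<theta>"
    and sp: "sparse_family \<eta> \<S> E"
    and f: "\<And>i x. i \<in> {1..n} \<Longrightarrow> 0 \<le> f i x" "\<And>i. i \<in> {1..n} \<Longrightarrow> locally_integrable (f i)"
  shows "multilinear_embedding n p \<sigma> K \<S> f ((ennreal (1 / \<eta>) *
    (\<Prod>i=1..n. ennreal (carleson_const (p i - (p i - 1) / \<theta>)) epowr (1 / p i))) *
      A0_bump \<theta> n r p \<sigma> K \<S> E)"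
proof -
  define q where "q i = p i - (p i - 1) / \<theta>" for i
  \<comment> \<open>With this root the power \<open>q i\<close> of \<open>h i\<close> is the
    integrand of \<open>wnorm\<close>, so the Carleson embedding with exponent \<open>q i\<close>
    returns the norm of \<open>f i\<close>.\<close>
  define h where "h i x = ennreal (\<bar>f i x\<bar> powr p i * \<sigma> i x) epowr (1 / q i)" for i x
  define J where "J i S = (\<integral>\<^sup>+x\<in>S. ennreal (f i x * \<sigma> i x) \<partial>lebesgue)" for i S
  define w where "w i S = wmeasure (\<lambda>x. \<sigma> i x powr \<theta>) S" for i S
  define b where "b i = 1 / (\<theta> * conj_exp (p i))" for i
  define a where "a i S = ((\<integral>\<^sup>+x\<in>S. h i x \<partial>lebesgue) / emeasure lebesgue S) epowr (q i / p i)" for i S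
  define Y where "Y i S = a i S * emeasure lebesgue (E S) epowr (1 / p i)" for i S
  define G where "G S = ennreal (K S) * emeasure lebesgue S ^ (n - 1) *
    (\<Prod>i=1..n. (w i S / emeasure lebesgue S) epowr b i)" for S
  define X where "X S = G S * emeasure lebesgue (E S) epowr (1 / r)" for S
  \<comment> \<open>Here \<theta> > 1 enters: \<theta> = 1 would give q_i = 1, where the denominator
    in \<open>carleson_const\<close> vanishes.\<close>
  have q: "1 < q i" if "i \<in> {1..n}" for i
  proof -
    have "(p i - 1) / \<theta> < p i - 1"
      using p[OF that] \<theta> by (simp add: divide_simps)
    then show ?thesis by (simp add: q_def)
  qed
  have b: "0 < b i" "q i / p i + b i = 1" if "i \<in> {1..n}" for i
    using p[OF that] \<theta> by (auto simp: b_def q_def conj_exp_def field_simps)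
  have meas [measurable]: "\<sigma> i \<in> borel_measurable lebesgue" "f i \<in> borel_measurable lebesgue"
    if "i \<in> {1..n}" for i
    using \<sigma>[OF that] f(2)[OF that] by (auto simp: weight_def locally_integrable_borel_measurable)
  have h [measurable]: "h i \<in> borel_measurable lebesgue" if "i \<in> {1..n}" for i
    using meas[OF that] unfolding h_def by measurable
  have J: "J i S \<le> emeasure lebesgue S * ((w i S / emeasure lebesgue S) epowr b i * a i S)"
    if i: "i \<in> {1..n}" and S: "S \<in> \<S>" for i S
  proof -
    let ?L = "emeasure lebesgue S"
    note cube = dyadic_cube_lebesgue[OF sparse_familyD(1)[OF sp S]]
    have q0: "0 < q i / p i" using p[OF i] q[OF i] by simp
    have "J i S \<le> (\<integral>\<^sup>+x\<in>S. h i x \<partial>lebesgue) epowr (q i / p i) * w i S epowr b i"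
      unfolding J_def h_def w_def b_def wmeasure_def
      using nn_integral_weight_bump_le[OF p[OF i] \<theta> f(1)[OF i] _ meas(2,1)[OF i] cube(1) q_def] \<sigma>[OF i] f(1)[OF i]
      by (simp add: weight_def)
    also have "\<dots> = ((\<integral>\<^sup>+x\<in>S. h i x \<partial>lebesgue) / ?L * ?L) epowr (q i / p i) * (w i S / ?L * ?L) epowr b i"
      by (simp only: ennreal_divide_mult_cancel[OF cube(2,3)])
    also have "\<dots> = ?L epowr (q i / p i + b i) * ((w i S / ?L) epowr b i * a i S)"
      using q0 b(1)[OF i] by (simp only: epowr_mult epowr_add a_def mult_ac)
    finally show ?thesis by (simp add: b(2)[OF i])
  qed
  have T: "ennreal (K S) * (\<Prod>i=1..n. J i S) \<le> ennreal (1 / \<eta>) * (X S * (\<Prod>i=1..n. Y i S))"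
    if S: "S \<in> \<S>" for S
  proof -
    let ?L = "emeasure lebesgue S" and ?E = "emeasure lebesgue (E S)"
    \<comment> \<open>A full power of |S| is traded for |E(S)|. As 1 = 1/r + 1/p_1 + ... + 1/p_n,
      the factor |E(S)| can be shared out among \<open>X\<close> and all the
      \<open>Y i\<close>.\<close>
    have "?L = ennreal (1 / \<eta>) * (ennreal \<eta> * ?L)"
      using \<eta> by (simp flip: mult.assoc ennreal_mult)
    also have "\<dots> \<le> ennreal (1 / \<eta>) * ?E"
      by (intro mult_left_mono sparse_familyD(4)[OF sp S]) simp
    also have "?E = ?E epowr (1 / r) * ?E epowr (\<Sum>i=1..n. 1 / p i)"
    proof -
      have "0 < (\<Sum>i=1..n. 1 / p i)"
        using n p by (intro sum_pos) (auto simp: less_trans[OF zero_less_one])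
      then show ?thesis using r by (subst epowr_add[symmetric]) auto
    qed
    also have "?E epowr (\<Sum>i=1..n. 1 / p i) = (\<Prod>i=1..n. ?E epowr (1 / p i))"
      using n p by (intro epowr_sum) (auto simp: less_trans[OF zero_less_one])
    finally have le: "?L \<le> ennreal (1 / \<eta>) * (?E epowr (1 / r) * (\<Prod>i=1..n. ?E epowr (1 / p i)))" .
    have "(\<Prod>i=1..n. J i S) \<le> (\<Prod>i=1..n. ?L * ((w i S / ?L) epowr b i * a i S))"
      using J S by (intro prod_mono_ennreal) auto
    also have "\<dots> = ?L ^ n * ((\<Prod>i=1..n. (w i S / ?L) epowr b i) * (\<Prod>i=1..n. a i S))"
      by (simp add: prod.distrib)
    also have "?L ^ n = ?L * ?L ^ (n - 1)"
      using n by (cases n) auto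
    finally have "ennreal (K S) * (\<Prod>i=1..n. J i S) \<le>
        ennreal (K S) * (?L * ?L ^ (n - 1) * ((\<Prod>i=1..n. (w i S / ?L) epowr b i) * (\<Prod>i=1..n. a i S)))"
      by (rule mult_left_mono) simp
    also have "\<dots> = ?L * (G S * (\<Prod>i=1..n. a i S))"
      by (simp add: G_def mult_ac)
    also have "\<dots> \<le> (ennreal (1 / \<eta>) * (?E epowr (1 / r) * (\<Prod>i=1..n. ?E epowr (1 / p i)))) *
        (G S * (\<Prod>i=1..n. a i S))"
      by (intro mult_right_mono le) simp
    finally show ?thesis by (simp add: X_def Y_def prod.distrib mult_ac)
  qed
  have Xr: "X S epowr r = G S epowr r * emeasure lebesgue (E S)" for S
    using r(1) by (simp add: X_def epowr_mult epowr_epowr)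
  have "(\<Sum>\<^sub>\<infinity>S\<in>\<S>. ennreal (K S) * (\<Prod>i=1..n. J i S)) \<le> (ennreal (1 / \<eta>) *
      (\<Prod>i=1..n. ennreal (carleson_const (q i)) epowr (1 / p i))) *
    (\<Sum>\<^sub>\<infinity>S\<in>\<S>. X S epowr r) epowr (1 / r) *
    (\<Prod>i=1..n. (\<integral>\<^sup>+x. ennreal (\<bar>f i x\<bar> powr p i * \<sigma> i x) \<partial>lebesgue) epowr (1 / p i))"
  proof (rule infsum_prod_le[OF _ r T])
    show "0 < p i" if "i \<in> {1..n}" for i using p[OF that] by simp
    fix F i assume F: "finite F" "F \<subseteq> \<S>" and i: "i \<in> {1..n}"
    have "(\<Sum>S\<in>F. Y i S epowr p i) \<le> ennreal (carleson_const (q i)) * (\<integral>\<^sup>+x. h i x epowr q i \<partial>lebesgue)"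
      unfolding Y_def a_def using p[OF i]
      by (intro lebesgue_carleson_embedding[OF _ q[OF i] h[OF i] F sp]) simp
    also have "(\<integral>\<^sup>+x. h i x epowr q i \<partial>lebesgue) = (\<integral>\<^sup>+x. ennreal (\<bar>f i x\<bar> powr p i * \<sigma> i x) \<partial>lebesgue)"
      unfolding h_def using q[OF i] by (simp add: epowr_epowr)
    finally show "(\<Sum>S\<in>F. Y i S epowr p i) \<le> ennreal (carleson_const (q i)) *
        (\<integral>\<^sup>+x. ennreal (\<bar>f i x\<bar> powr p i * \<sigma> i x) \<partial>lebesgue)" .
  qed
  then show ?thesis
    unfolding multilinear_embedding_def A0_bump_def wnorm_def Xr J_def G_def w_def b_def q_def .
qed

section \<open>Finiteness of the constants and conclusion of both cases\<close>

lemma prod_less_top_ennreal: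
  fixes f :: "'a \<Rightarrow> ennreal"
  shows "(\<And>i. i \<in> I \<Longrightarrow> f i < top) \<Longrightarrow> prod f I < top"
  by (induction I rule: infinite_finite_induct) (auto intro: ennreal_mult_less_top[THEN iffD2])

theorem theorem1p2:
  fixes n :: nat
    and \<sigma> :: "nat \<Rightarrow> real ^ 'd \<Rightarrow> real"
    and p :: "nat \<Rightarrow> real"
    and \<eta> r :: real
  assumes "2 \<le> n"
    and "\<And>i. i \<in> {1..n} \<Longrightarrow> weight (\<sigma> i)"
    and "0 < \<eta>" and "\<eta> < 1"
    and "\<And>i. i \<in> {1..n} \<Longrightarrow> 1 < p i"
    and "(\<Sum>i=1..n. 1 / p i) < 1"
    and "1 / r + (\<Sum>i=1..n. 1 / p i) = 1"
  shows "((\<forall>i\<in>{1..n}. A_infty (\<sigma> i)) \<longrightarrow>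
      (\<exists>c::real. 0 \<le> c \<and>
        (\<forall>(K :: (real ^ 'd) set \<Rightarrow> real) \<S> E (f :: nat \<Rightarrow> real ^ 'd \<Rightarrow> real).
          (\<forall>Q\<in>dyadic_cubes. 0 \<le> K Q) \<longrightarrow>
          sparse_family \<eta> \<S> E \<longrightarrow>
          (\<forall>i\<in>{1..n}. (\<forall>x. 0 \<le> f i x) \<and> locally_integrable (f i)) \<longrightarrow>
          A0_weights n r p \<sigma> K \<S> E < top \<longrightarrow>
          multilinear_embedding n p \<sigma> K \<S> f (ennreal c * A0_weights n r p \<sigma> K \<S> E)))) \<and>
    (\<forall>\<theta>>1.
      (\<exists>c::real. 0 \<le> c \<and>
        (\<forall>(K :: (real ^ 'd) set \<Rightarrow> real) \<S> E (f :: nat \<Rightarrow> real ^ 'd \<Rightarrow> real).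
          (\<forall>Q\<in>dyadic_cubes. 0 \<le> K Q) \<longrightarrow>
          sparse_family \<eta> \<S> E \<longrightarrow>
          (\<forall>i\<in>{1..n}. (\<forall>x. 0 \<le> f i x) \<and> locally_integrable (f i)) \<longrightarrow>
          A0_bump \<theta> n r p \<sigma> K \<S> E < top \<longrightarrow>
          multilinear_embedding n p \<sigma> K \<S> f (ennreal c * A0_bump \<theta> n r p \<sigma> K \<S> E))))"
proof (intro conjI impI allI)
  have "0 < 1 / r" using assms(6,7) by linarith
  then have r: "0 < r" by simp
  have p0: "0 < 1 / p i" if "i \<in> {1..n}" for i using assms(5)[OF that] by simp
  {
    assume "\<forall>i\<in>{1..n}. A_infty (\<sigma> i)"
    \<comment> \<open>The constants \<open>D i\<close> are fixed before \<open>K\<close>,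
      \<open>\<S>\<close>, \<open>E\<close> and \<open>f\<close> are introduced, which makes
      \<open>C\<close> uniform in them.\<close>
    then have "\<forall>i\<in>{1..n}. \<exists>D<top. \<forall>S E. S \<in> dyadic_cubes \<longrightarrow> E \<in> sets lebesgue \<longrightarrow> E \<subseteq> S \<longrightarrow>
        ennreal \<eta> * emeasure lebesgue S \<le> emeasure lebesgue E \<longrightarrow> wmeasure (\<sigma> i) S \<le> D * wmeasure (\<sigma> i) E"
      using A_infty_sparse_le[OF _ assms(3)] by metis
    then obtain D where D: "\<And>i. i \<in> {1..n} \<Longrightarrow> D i < top"
      "\<And>i S E. i \<in> {1..n} \<Longrightarrow> S \<in> dyadic_cubes \<Longrightarrow> E \<in> sets lebesgue \<Longrightarrow> E \<subseteq> S \<Longrightarrow>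
        ennreal \<eta> * emeasure lebesgue S \<le> emeasure lebesgue E \<Longrightarrow> wmeasure (\<sigma> i) S \<le> D i * wmeasure (\<sigma> i) E"
      by metis
    define C where "C = ennreal (1 / \<eta>) epowr (1 / r) *
      (\<Prod>i=1..n. (D i * ennreal (carleson_const (p i))) epowr (1 / p i))"
    have "C < top"
      unfolding C_def using r p0 D(1)
      by (intro ennreal_mult_less_top[THEN iffD2] disjI2 conjI prod_less_top_ennreal)
        (auto simp: epowr_less_top_iff ennreal_mult_less_top)
    then have C: "ennreal (enn2real C) = C" by simp
    have "multilinear_embedding n p \<sigma> K \<S> f (C * A0_weights n r p \<sigma> K \<S> E)"
      if "sparse_family \<eta> \<S> E" "\<forall>i\<in>{1..n}. (\<forall>x. 0 \<le> f i x) \<and> locally_integrable (f i)" for K \<S> E f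
      unfolding C_def using that assms(1-3,5,7) r
      by (intro embedding_A_infty D(2)) (auto dest: sparse_familyD)
    then show "\<exists>c::real. 0 \<le> c \<and>
        (\<forall>(K :: (real ^ 'd) set \<Rightarrow> real) \<S> E (f :: nat \<Rightarrow> real ^ 'd \<Rightarrow> real).
          (\<forall>Q\<in>dyadic_cubes. 0 \<le> K Q) \<longrightarrow>
          sparse_family \<eta> \<S> E \<longrightarrow>
          (\<forall>i\<in>{1..n}. (\<forall>x. 0 \<le> f i x) \<and> locally_integrable (f i)) \<longrightarrow>
          A0_weights n r p \<sigma> K \<S> E < top \<longrightarrow>
          multilinear_embedding n p \<sigma> K \<S> f (ennreal c * A0_weights n r p \<sigma> K \<S> E))"
      using C by (intro exI[of _ "enn2real C"]) simp
  next
    fix \<theta> :: real assume \<theta>: "1 < \<theta>"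
    \<comment> \<open>In case (b) the constant involves only n, \<eta>, \<theta> and the exponents
      p_i, not the weights.\<close>
    define C where "C = ennreal (1 / \<eta>) *
      (\<Prod>i=1..n. ennreal (carleson_const (p i - (p i - 1) / \<theta>)) epowr (1 / p i))"
    have "C < top"
      unfolding C_def using p0
      by (intro ennreal_mult_less_top[THEN iffD2] disjI2 conjI prod_less_top_ennreal)
        (auto simp: epowr_less_top_iff)
    then have C: "ennreal (enn2real C) = C" by simp
    have "multilinear_embedding n p \<sigma> K \<S> f (C * A0_bump \<theta> n r p \<sigma> K \<S> E)"
      if "sparse_family \<eta> \<S> E" "\<forall>i\<in>{1..n}. (\<forall>x. 0 \<le> f i x) \<and> locally_integrable (f i)" for K \<S> E f
      unfolding C_def using that assms(1-3,5,7) r \<theta>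
      by (intro embedding_bump) auto
    then show "\<exists>c::real. 0 \<le> c \<and>
        (\<forall>(K :: (real ^ 'd) set \<Rightarrow> real) \<S> E (f :: nat \<Rightarrow> real ^ 'd \<Rightarrow> real).
          (\<forall>Q\<in>dyadic_cubes. 0 \<le> K Q) \<longrightarrow>
          sparse_family \<eta> \<S> E \<longrightarrow>
          (\<forall>i\<in>{1..n}. (\<forall>x. 0 \<le> f i x) \<and> locally_integrable (f i)) \<longrightarrow>
          A0_bump \<theta> n r p \<sigma> K \<S> E < top \<longrightarrow>
          multilinear_embedding n p \<sigma> K \<S> f (ennreal c * A0_bump \<theta> n r p \<sigma> K \<S> E))"
      using C by (intro exI[of _ "enn2real C"]) simp
  }
qed

end
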